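(* Let $T$ be a tree on $n \geq 5$ vertices and let $\mathcal{L}_q^T = I + (D-I)q^2 - qA$ be its $q$-Laplacian. Then for every integer $k$ with $2 \leq k \leq \lfloor n/2 \rfloor$ and for all $q \in \mathbb{R}$, $$\overline{\mathrm{imm}}_{(n-k+1,\,k-1)}(\mathcal{L}_q^T) \;\geq\; \overline{\mathrm{imm}}_{(n-k,\,k)}(\mathcal{L}_q^T).$$
   Context: For a graph $G$ on $n$ vertices, $A$ is its adjacency matrix, $D$ the diagonal matrix of vertex degrees, $I$ the identity matrix, and the $q$-Laplacian is $\mathcal{L}_q^G = I + (D-I)q^2 - qA$ (a matrix with entries polynomial in $q$). For a partition $\lambda \vdash n$ let $\chi_\lambda$ be the character of the irreducible complex representation of the symmetric group $\mathfrak{S}_n$ indexed by $\lambda$. For an $n\times n$ matrix $M=(m_{i,j})$, the normalized immanant is $\overline{\mathrm{imm}}_\lambda(M) = \frac{1}{\chi_\lambda(\mathrm{id})}\sum_{\pi\in\mathfrak{S}_n}\chi_\lambda(\pi)\prod_{i=1}^n m_{i,\pi(i)}$. The partitions $(n-k,k)$ are the partitions of $n$ with at most two rows. *)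

theory Defs
  imports
    "Jordan_Normal_Form.Matrix"
    "HOL-Library.Complex_Order"
    "HOL-Library.Function_Algebras"
    "HOL-Combinatorics.Permutations"
begin

section \<open>Trees and the \<open>q\<close>-Laplacian\<close>

definition simple_graph :: "'v set \<Rightarrow> 'v set set \<Rightarrow> bool" where
  "simple_graph V E \<longleftrightarrow> finite V \<and> (\<forall>e\<in>E. e \<subseteq> V \<and> card e = 2)"

definition connected_graph :: "'v set \<Rightarrow> 'v set set \<Rightarrow> bool" where
  "connected_graph V E \<longleftrightarrow> V \<noteq> {} \<and> (\<forall>u\<in>V. \<forall>v\<in>V. (u, v) \<in> {(x, y). {x, y} \<in> E}\<^sup>*)"

definition graph_cycle :: "'v set set \<Rightarrow> 'v list \<Rightarrow> bool" where
  "graph_cycle E c \<longleftrightarrow> length c \<ge> 3 \<and> distinct c \<and>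
     (\<forall>i<length c. {c ! i, c ! (Suc i mod length c)} \<in> E)"

definition is_tree :: "'v set \<Rightarrow> 'v set set \<Rightarrow> bool" where
  "is_tree V E \<longleftrightarrow> simple_graph V E \<and> connected_graph V E \<and> \<not> (\<exists>c. graph_cycle E c)"

definition adjacency_matrix :: "nat \<Rightarrow> nat set set \<Rightarrow> 'a::comm_ring_1 mat" where
  "adjacency_matrix n E = mat n n (\<lambda>(i, j). if {i, j} \<in> E then 1 else 0)"

definition degree_matrix :: "nat \<Rightarrow> nat set set \<Rightarrow> 'a::comm_ring_1 mat" where
  "degree_matrix n E = mat n n (\<lambda>(i, j). if i = j then of_nat (card {e \<in> E. i \<in> e}) else 0)"

definition q_laplacian :: "nat \<Rightarrow> nat set set \<Rightarrow> 'a::comm_ring_1 \<Rightarrow> 'a mat" where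
  "q_laplacian n E q =
     1\<^sub>m n + q\<^sup>2 \<cdot>\<^sub>m (degree_matrix n E - 1\<^sub>m n) - q \<cdot>\<^sub>m adjacency_matrix n E"

section \<open>Irreducible characters of the symmetric group\<close>

definition fun_scale :: "complex \<Rightarrow> ('x \<Rightarrow> complex) \<Rightarrow> 'x \<Rightarrow> complex" where
  "fun_scale c f = (\<lambda>x. c * f x)"

global_interpretation fun_vs: vector_space fun_scale
  by unfold_locales (auto simp: fun_scale_def algebra_simps fun_eq_iff)

text \<open>The trace of an endomorphism \<open>f\<close> of a finite-dimensional subspace \<open>V\<close>; the value does not
  depend on the basis that is chosen.\<close>

definition trace_on :: "('x \<Rightarrow> complex) set \<Rightarrow> (('x \<Rightarrow> complex) \<Rightarrow> 'x \<Rightarrow> complex) \<Rightarrow> complex" where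
  "trace_on V f =
     (let B = (SOME B. fun_vs.independent B \<and> fun_vs.span B = V)
      in \<Sum>b\<in>B. fun_vs.representation B (f b) b)"

text \<open>A partition of \<open>n\<close> is the weakly decreasing list of its positive parts.  The irreducible
  representation of the symmetric group on \<open>{0..<n}\<close> indexed by \<open>\<mu>\<close> is the Specht module, i.e. the
  span of the polytabloids of shape \<open>\<mu>\<close> (so \<open>[n]\<close> indexes the trivial and \<open>[1, \<dots>, 1]\<close> the sign
  representation).  A tableau is the list of its rows, each row being a list of entries; its
  tabloid is the list of the row sets.  The permutation module on the tabloids consists of
  complex functions on tabloids.\<close>

type_synonym tableau = "nat list list"
type_synonym tabloid = "nat set list"

definition tableaux :: "nat list \<Rightarrow> tableau set" where
  "tableaux \<mu> = {t. map length t = \<mu> \<and> distinct (concat t) \<and> set (concat t) = {0..<sum_list \<mu>}}"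

definition tabloid_of :: "tableau \<Rightarrow> tabloid" where
  "tabloid_of t = map set t"

definition column :: "tableau \<Rightarrow> nat \<Rightarrow> nat set" where
  "column t j = {r ! j | r. r \<in> set t \<and> j < length r}"

definition column_stabilizer :: "tableau \<Rightarrow> (nat \<Rightarrow> nat) set" where
  "column_stabilizer t = {\<pi>. \<pi> permutes set (concat t) \<and> (\<forall>j. \<pi> ` column t j = column t j)}"

definition polytabloid :: "tableau \<Rightarrow> tabloid \<Rightarrow> complex" where
  "polytabloid t = (\<lambda>X. \<Sum>\<pi>\<in>column_stabilizer t.
     of_int (sign \<pi>) * (if tabloid_of (map (map \<pi>) t) = X then 1 else 0))"

definition specht_module :: "nat list \<Rightarrow> (tabloid \<Rightarrow> complex) set" where
  "specht_module \<mu> = fun_vs.span (polytabloid ` tableaux \<mu>)"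

definition perm_action :: "(nat \<Rightarrow> nat) \<Rightarrow> (tabloid \<Rightarrow> complex) \<Rightarrow> tabloid \<Rightarrow> complex" where
  "perm_action \<pi> f = (\<lambda>X. f (map ((`) (inv_into UNIV \<pi>)) X))"

definition irr_char :: "nat list \<Rightarrow> (nat \<Rightarrow> nat) \<Rightarrow> complex" where
  "irr_char \<mu> \<pi> = trace_on (specht_module \<mu>) (perm_action \<pi>)"

text \<open>Immanants are complex numbers that happen to be real for real matrices.  They are compared in the
  order on the complex numbers where \<open>x \<le> y\<close> iff \<open>y - x\<close> is a nonnegative real.\<close>

definition normalized_immanant :: "nat list \<Rightarrow> complex mat \<Rightarrow> complex" where
  "normalized_immanant \<mu> M =
     1 / irr_char \<mu> id *
     (\<Sum>\<pi> | \<pi> permutes {0..<dim_row M}.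
        irr_char \<mu> \<pi> * (\<Prod>i = 0..<dim_row M. M $$ (i, \<pi> i)))"

end

theory Submission
  imports Defs "HOL-Computational_Algebra.Polynomial"
begin

text \<open>
  For a tree only the involutions \<open>\<pi>\<close> coming from matchings contribute to an immanant of the
  \<open>q\<close>-Laplacian.  Put \<open>t = q\<^sup>2\<close> and let \<open>a\<^sub>j\<close> be the total weight of the matchings with \<open>j\<close> edges.
  Contracting leaves one after the other shows that \<open>\<Sum> a\<^sub>j (z - 1)\<^sup>j = \<Sum> b\<^sub>i z\<^sup>i\<close> with \<open>b\<^sub>0 = 1 - t\<close> and
  \<open>b\<^sub>i \<ge> 0\<close> for \<open>i \<ge> 1\<close>.

  The Specht module of shape \<open>(n - k, k)\<close> is the kernel of the map from functions on \<open>k\<close>-subsets to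
  functions on \<open>(k - 1)\<close>-subsets, which is surjective.  So the character is the difference of two
  permutation characters, and on an involution with \<open>j\<close> transpositions it is the coefficient of \<open>x\<^sup>k\<close> in
  \<open>(1 - x)(1 + x)\<^sup>n\<^sup>-\<^sup>2\<^sup>j(1 + x\<^sup>2)\<^sup>j\<close>.  Since \<open>(1 + x)\<^sup>2 + (1 + x\<^sup>2) = 2(1 + x + x\<^sup>2)\<close>, the immanant becomes
  \<open>\<Sum> b\<^sub>i 2\<^sup>i f\<^sub>i(k)\<close> where \<open>f\<^sub>i(k)\<close> is the coefficient of \<open>x\<^sup>k\<close> in \<open>(1 - x)(1 + x)\<^sup>n\<^sup>-\<^sup>2\<^sup>i(1 + x + x\<^sup>2)\<^sup>i\<close>, and the
  degree of the character is \<open>f\<^sub>0(k)\<close>.  It remains to see that \<open>f\<^sub>i(k) / f\<^sub>0(k)\<close> decreases in \<open>k\<close>; the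
  possibly negative \<open>b\<^sub>0\<close> is harmless because this ratio is constant for \<open>i = 0\<close>.
\<close>

section \<open>Monotonicity of multiplicity ratios\<close>

text \<open>Why the ratios decrease: f_i and f_0 are multiplicity sequences of SU(2), for V_1^(n-2i)
  tensor V_2^i and for V_1^n, so the claim is a likelihood ratio comparison on one half of two
  antisymmetric sequences. Adding a factor V_1 on both sides preserves it. Adding V_2 on one side
  and V_1 tensor V_1 = V_2 + V_0 on the other is harder: V_2 alone does not preserve the order at
  weight zero, where the comparison becomes a growth bound for Riordan numbers. That bound fails at
  i = 2, so the small cases are started separately.

  Why the characters take work: they are traces on a span of polytabloids in an arbitrarily chosen
  basis. The trace is evaluated through the projection 1 - S down, where S is a right inverse of the
  lowering map. S need not be equivariant; the lowering map is, so cyclicity of the trace turns the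
  correction term into a permutation character. One commutation relation between raising and
  lowering maps yields both S below the middle level and injectivity above it.\<close>

definition int_coeff :: "real poly \<Rightarrow> int \<Rightarrow> real" where
  "int_coeff p k = (if k < 0 then 0 else coeff p (nat k))"

definition two_row_poly :: "nat \<Rightarrow> nat \<Rightarrow> real poly" where
  "two_row_poly m i = [:1, -1:] * [:1, 1:] ^ m * [:1, 1, 1:] ^ i"

text \<open>\<open>two_row_mult m i k\<close> is the multiplicity of the irreducible representation of \<open>SU\<^sub>2\<close> of highest
  weight \<open>m + 2 i - 2 k\<close> in \<open>V\<^sub>1\<^sup>\<otimes>\<^sup>m \<otimes> V\<^sub>2\<^sup>\<otimes>\<^sup>i\<close>, extended antisymmetrically to weights below zero.\<close>

definition two_row_mult :: "nat \<Rightarrow> nat \<Rightarrow> int \<Rightarrow> real" where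
  "two_row_mult m i k = int_coeff (two_row_poly m i) k"

lemma int_coeff_add: "int_coeff (p + q) k = int_coeff p k + int_coeff q k"
  by (simp add: int_coeff_def)

text \<open>Integer indices make multiplication by x an unconditional shift, so the recurrences
  below have no boundary case at k = 0.\<close>

lemma int_coeff_pCons_0: "int_coeff (pCons 0 p) k = int_coeff p (k - 1)"
  by (cases "nat k") (auto simp: int_coeff_def coeff_pCons nat_diff_distrib)

lemma two_row_mult_0_0: "two_row_mult 0 0 k = (if k = 0 then 1 else if k = 1 then -1 else 0)"
proof -
  consider "k < 0" | "k = 0" | "k = 1" | "k \<ge> 2" by linarith
  then show ?thesis
  proof cases
    case 4
    then have "nat k = Suc (Suc (nat (k - 2)))" by simp
    with 4 show ?thesis by (simp add: two_row_mult_def two_row_poly_def int_coeff_def)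
  qed (auto simp: two_row_mult_def two_row_poly_def int_coeff_def)
qed

lemma two_row_mult_Suc:
  "two_row_mult (Suc m) i k = two_row_mult m i k + two_row_mult m i (k - 1)"
proof -
  have "two_row_poly (Suc m) i = [:1, 1:] * two_row_poly m i"
    by (simp only: two_row_poly_def power_Suc mult_ac)
  also have "\<dots> = two_row_poly m i + pCons 0 (two_row_poly m i)" by simp
  finally show ?thesis by (simp add: two_row_mult_def int_coeff_add int_coeff_pCons_0)
qed

lemma two_row_mult_Suc_right:
  "two_row_mult m (Suc i) k =
     two_row_mult m i k + two_row_mult m i (k - 1) + two_row_mult m i (k - 2)"
proof -
  let ?p = "two_row_poly m i"
  have "two_row_poly m (Suc i) = [:1, 1, 1:] * ?p"
    by (simp only: two_row_poly_def power_Suc mult_ac)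
  also have "\<dots> = ?p + pCons 0 (?p + pCons 0 ?p)" by simp
  finally show ?thesis by (simp add: two_row_mult_def int_coeff_add int_coeff_pCons_0)
qed

lemma two_row_mult_neg: "k < 0 \<Longrightarrow> two_row_mult m i k = 0"
  by (simp add: two_row_mult_def int_coeff_def)

text \<open>\<open>two_row_poly m i\<close> is antipalindromic of degree m + 2i + 1: reversal
  negates 1 - x and preserves the other two factors.\<close>

lemma two_row_mult_antisym:
  "two_row_mult m i k = - two_row_mult m i (int m + 2 * int i + 1 - k)"
proof (induction i arbitrary: k)
  case 0
  show ?case
  proof (induction m arbitrary: k)
    case 0
    show ?case by (simp add: two_row_mult_0_0)
  next
    case (Suc m)
    show ?case
      unfolding two_row_mult_Suc using Suc[of k] Suc[of "k - 1"] by (simp add: algebra_simps)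
  qed
next
  case (Suc i)
  show ?case
    unfolding two_row_mult_Suc_right using Suc[of k] Suc[of "k - 1"] Suc[of "k - 2"]
    by (simp add: algebra_simps)
qed

lemma two_row_mult_middle: "2 * k = int m + 2 * int i + 1 \<Longrightarrow> two_row_mult m i k = 0"
proof -
  assume "2 * k = int m + 2 * int i + 1"
  then have "int m + 2 * int i + 1 - k = k" by simp
  then have "two_row_mult m i k = - two_row_mult m i k" using two_row_mult_antisym[of m i k] by metis
  then show ?thesis by simp
qed

text \<open>The recurrences stay inside the nonnegative half except next to the centre of the
  reflection; there the value is zero, or the terms at k and k - 1 are mirror images and
  cancel.\<close>

lemma two_row_mult_nonneg:
  "2 * k \<le> int m + 2 * int i + 1 \<Longrightarrow> two_row_mult m i k \<ge> 0"
proof (induction i arbitrary: k)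
  case 0
  then show ?case
  proof (induction m arbitrary: k)
    case 0
    then show ?case by (auto simp: two_row_mult_0_0)
  next
    case (Suc m)
    show ?case
    proof (cases "2 * k = int m + 2")
      case True
      with two_row_mult_middle[of k "Suc m" 0] show ?thesis by simp
    next
      case False
      with Suc.prems have "2 * k \<le> int m + 1" by simp
      with Suc.IH[of k] Suc.IH[of "k - 1"] show ?thesis by (simp add: two_row_mult_Suc)
    qed
  qed
next
  case (Suc i)
  consider "2 * k = int m + 2 * int i + 3" | "2 * k = int m + 2 * int i + 2"
    | "2 * k \<le> int m + 2 * int i + 1"
    using Suc.prems by fastforce
  then show ?case
  proof cases
    case 1
    with two_row_mult_middle[of k m "Suc i"] show ?thesis by simp
  next
    case 2
    then have "int m + 2 * int i + 1 - k = k - 1" by simp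
    then have "two_row_mult m i k = - two_row_mult m i (k - 1)"
      using two_row_mult_antisym[of m i k] by metis
    with Suc.IH[of "k - 2"] 2 show ?thesis by (simp add: two_row_mult_Suc_right)
  next
    case 3
    with Suc.IH[of k] Suc.IH[of "k - 1"] Suc.IH[of "k - 2"] show ?thesis
      by (simp add: two_row_mult_Suc_right)
  qed
qed

section \<open>Ballot numbers, the case i = 0\<close>

abbreviation ballot :: "nat \<Rightarrow> int \<Rightarrow> real" where
  "ballot n \<equiv> two_row_mult n 0"

text \<open>The classical C(n,k) - C(n,k-1) with denominators cleared. The pair k, l is exchanged by
  the reflection, so the formula covers both halves with the right sign.\<close>

lemma ballot_fact:
  "k + l = n + 1 \<Longrightarrow> ballot n (int k) * fact k * fact l = fact n * (real l - real k)"
proof (induction n arbitrary: k l)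
  case 0
  then show ?case by (cases k) (auto simp: two_row_mult_0_0)
next
  case (Suc n)
  show ?case
  proof (cases k)
    case 0
    have "ballot m 0 = 1" for m
      by (induction m) (auto simp: two_row_mult_0_0 two_row_mult_Suc two_row_mult_neg)
    with 0 Suc.prems show ?thesis by (simp add: algebra_simps)
  next
    case k: (Suc k')
    show ?thesis
    proof (cases l)
      case 0
      \<comment> \<open>The index m + 2 exceeds the degree; the reflection sends it to -1.\<close>
      have z: "ballot m (int m + 2) = 0" for m
        using two_row_mult_antisym[of m 0 "int m + 2"] by (simp add: two_row_mult_neg)
      have "ballot n (int k') * fact k' = - (fact n * real k')"
        using Suc.IH[of k' 0] Suc.prems k 0 by simp
      moreover have "ballot (Suc n) (int k) = ballot n (int k')"
        using z[of n] k 0 Suc.prems by (simp add: two_row_mult_Suc add_ac)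
      moreover have "k' = Suc n" using k 0 Suc.prems by simp
      moreover have "ballot (Suc n) (int k) * fact k * fact l =
          real k * (ballot (Suc n) (int k) * fact k')"
        using k 0 by simp
      ultimately have "ballot (Suc n) (int k) * fact k * fact l = real k * - (fact n * real (Suc n))"
        by simp
      then show ?thesis using 0 by simp
    next
      case l: (Suc l')
      have n: "real n = real k' + real l'" using Suc.prems k l by simp
      have 1: "ballot n (int k') * fact k' * fact l = fact n * (real l - real k')"
        using Suc.prems k l by (intro Suc.IH) simp
      have 2: "ballot n (int k) * fact k * fact l' = fact n * (real l' - real k)"
        using Suc.prems k l by (intro Suc.IH) simp
      have "ballot (Suc n) (int k) * fact k * fact l =
              (ballot n (int k) * fact k * fact l') * real l +
              (ballot n (int k') * fact k' * fact l) * real k"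
        using k l by (simp add: two_row_mult_Suc algebra_simps)
      also have "\<dots> = fact n * ((real l' - real k) * real l + (real l - real k') * real k)"
        unfolding 1 2 by (simp add: algebra_simps)
      also have "(real l' - real k) * real l + (real l - real k') * real k = real (Suc n) * (real l - real k)"
        using n k l by (simp add: algebra_simps)
      finally show ?thesis by simp
    qed
  qed
qed

lemma ballot_pos:
  assumes "0 \<le> k" "2 * k \<le> int n"
  shows "ballot n k > 0"
proof -
  obtain k' where k: "k = int k'" using assms nonneg_int_cases by blast
  define l where "l = n + 1 - k'"
  have "k' + l = n + 1" "l > k'" using assms k by (auto simp: l_def)
  then have "ballot n k * (fact k' * fact l) > 0"
    using ballot_fact[of k' l n] k by (simp add: mult.assoc)
  moreover have "fact k' * fact l > (0::real)" by simp
  ultimately show ?thesis by (metis zero_less_mult_pos2)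
qed

lemma ballot_nonneg: "2 * k \<le> int n \<Longrightarrow> ballot n k \<ge> 0"
  using two_row_mult_nonneg[of k n 0] by simp

text \<open>Passing from (n, k - 1) to (n + 2, k) keeps the weight n + 2 - 2k, hence the factor l -
  k of \<open>ballot_fact\<close>, and only factorials remain in the quotient.\<close>

lemma ballot_ratio:
  assumes "0 \<le> k" "k \<le> int n + 2"
  shows "(real n + 2) * (real n + 1) * ballot n (k - 1) =
           of_int k * (real n + 3 - of_int k) * ballot (n + 2) k"
proof -
  obtain k' where k: "k = int k'" using assms nonneg_int_cases by blast
  show ?thesis
  proof (cases k')
    case 0
    with k show ?thesis by (simp add: two_row_mult_neg)
  next
    case (Suc j)
    define l where "l = n + 2 - k'"
    have s: "j + l = n + 1" using assms k Suc by (auto simp: l_def)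
    have 1: "ballot n (int j) * fact j * fact l = fact n * (real l - real j)"
      using s by (rule ballot_fact)
    have 2: "ballot (n + 2) (int k') * fact k' * fact (Suc l) = fact (n + 2) * (real (Suc l) - real k')"
      using s Suc by (intro ballot_fact) simp
    have "(real n + 2) * (real n + 1) * (ballot n (int j) * fact j * fact l)
            = real k' * real (Suc l) * (ballot (n + 2) (int k') * fact j * fact l)"
      unfolding 1 using 2 Suc by (simp add: algebra_simps)
    then have "((real n + 2) * (real n + 1) * ballot n (int j)) * (fact j * fact l)
            = (real k' * real (Suc l) * ballot (n + 2) (int k')) * (fact j * fact l)"
      by (simp add: mult_ac)
    then have "(real n + 2) * (real n + 1) * ballot n (int j) = real k' * real (Suc l) * ballot (n + 2) (int k')"
      by simp
    moreover have "real (Suc l) = real n + 3 - of_int k" "k - 1 = int j"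
      using s Suc k by auto
    ultimately show ?thesis using k by simp
  qed
qed

text \<open>The quotient 3i / (i + 2) of the ballot numbers at weights two and zero is the growth
  rate that the Riordan numbers must reach in \<open>riordan_growth\<close>.\<close>

lemma ballot_center:
  assumes "i \<ge> 1"
  shows "(real i + 2) * ballot (2 * i) (int i - 1) = 3 * real i * ballot (2 * i) (int i)"
proof -
  obtain j where j: "i = Suc j" using assms by (cases i) auto
  have 1: "ballot (2 * i) (int i) * fact i * fact (i + 1) = fact (2 * i) * (real (i + 1) - real i)"
    by (rule ballot_fact) simp
  have 2: "ballot (2 * i) (int j) * fact j * fact (i + 2) = fact (2 * i) * (real (i + 2) - real j)"
    by (rule ballot_fact) (use j in simp)
  have "((real i + 2) * ballot (2 * i) (int j)) * (fact j * fact (i + 1)) = 3 * fact (2 * i)"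
    using 2 j by (simp add: algebra_simps)
  also have "\<dots> = (3 * real i * ballot (2 * i) (int i)) * (fact j * fact (i + 1))"
    using 1 j by (simp add: algebra_simps)
  finally show ?thesis using j by simp
qed

section \<open>Coefficients of (1/x + 1 + x)^n and Riordan numbers\<close>

fun trinomial :: "nat \<Rightarrow> int \<Rightarrow> real" where
  "trinomial 0 a = (if a = 0 then 1 else 0)"
| "trinomial (Suc n) a = trinomial n (a - 1) + trinomial n a + trinomial n (a + 1)"

lemma trinomial_sym: "trinomial n (- a) = trinomial n a"
proof (induction n arbitrary: a)
  case (Suc n)
  have "- a - 1 = - (a + 1)" "- a + 1 = - (a - 1)" by simp_all
  then have "trinomial n (- a - 1) = trinomial n (a + 1)" "trinomial n (- a + 1) = trinomial n (a - 1)"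
    by (simp_all only: Suc)
  with Suc[of a] show ?case by simp
qed simp

text \<open>Comparing coefficients in \<open>P \<cdot> x (P\<^sup>n)' = n P\<^sup>n (x - 1/x)\<close> for \<open>P = x + 1 + 1/x\<close>.\<close>

lemma trinomial_recurrence:
  "(real n - of_int a + 1) * trinomial n (a - 1) - of_int a * trinomial n a
     - (real n + of_int a + 1) * trinomial n (a + 1) = 0"
proof (induction n arbitrary: a)
  case (Suc n)
  show ?case using Suc[of "a - 1"] Suc[of a] Suc[of "a + 1"] by (simp add: algebra_simps)
qed auto

lemma two_row_mult_0_eq_trinomial:
  "two_row_mult 0 i k = trinomial i (int i - k) - trinomial i (int i - k + 1)"
proof (induction i arbitrary: k)
  case 0
  show ?case by (auto simp: two_row_mult_0_0)
next
  case (Suc i)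
  show ?case unfolding two_row_mult_Suc_right Suc.IH by (simp add: algebra_simps)
qed

text \<open>The multiplicity of the trivial representation in the n-th tensor power of V_2: 1, 0, 1,
  1, 3, 6, ...\<close>

definition riordan :: "nat \<Rightarrow> real" where
  "riordan n = two_row_mult 0 n (int n)"

lemma riordan_eq: "riordan n = trinomial n 0 - trinomial n 1"
  by (simp add: riordan_def two_row_mult_0_eq_trinomial)

text \<open>V_2 is self-dual, so invariants in n + 1 factors V_2 correspond to copies of V_2 in n
  factors.\<close>

lemma riordan_Suc: "riordan (Suc n) = two_row_mult 0 n (int n - 1)"
  using trinomial_sym[of n 1] by (simp add: riordan_eq two_row_mult_0_eq_trinomial)

lemma riordan_recurrence:
  "(real n + 3) * riordan (n + 2) = (real n + 1) * (2 * riordan (n + 1) + 3 * riordan n)"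
proof -
  have A: "(real n + 2) * trinomial n 2 = real n * trinomial n 0 - trinomial n 1" for n
    using trinomial_recurrence[of n 1] by simp
  have s: "trinomial n (-1) = trinomial n 1" for n using trinomial_sym[of n 1] by simp
  have r: "riordan (Suc m) = trinomial m 1 - trinomial m 2" for m
    using s[of m] by (simp add: riordan_eq)
  have B: "(real m + 2) * riordan (Suc m) = (real m + 3) * trinomial m 1 - real m * trinomial m 0" for m
    using A[of m] by (simp add: r algebra_simps)
  \<comment> \<open>Everything reduces to these two coefficients: \<open>A\<close> eliminates
    \<open>trinomial n 2\<close> at the price of a factor n + 2, which is cancelled at the
    end.\<close>
  define x y where "x = trinomial n 0" and "y = trinomial n 1"
  have x1: "trinomial (Suc n) 0 = x + 2 * y" using s[of n] by (simp add: x_def y_def)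
  have y1: "(real n + 2) * trinomial (Suc n) 1 = (real n + 2) * (x + y) + (real n * x - y)"
    using A[of n] by (simp add: x_def y_def algebra_simps)
  have "(real n + 3) * riordan (n + 2) =
          (real n + 4) * trinomial (Suc n) 1 - (real n + 1) * trinomial (Suc n) 0"
    using B[of "Suc n"] by (simp add: add_ac del: trinomial.simps)
  then have "(real n + 2) * ((real n + 3) * riordan (n + 2)) =
          (real n + 4) * ((real n + 2) * trinomial (Suc n) 1)
          - (real n + 2) * (real n + 1) * trinomial (Suc n) 0"
    by (simp only:) (simp add: algebra_simps del: trinomial.simps)
  also have "\<dots> = (real n + 4) * ((real n + 2) * (x + y) + (real n * x - y))
          - (real n + 2) * (real n + 1) * (x + 2 * y)"
    unfolding x1 y1 ..
  also have "\<dots> = (real n + 1) * (2 * ((real n + 3) * y - real n * x) + 3 * ((real n + 2) * (x - y)))"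
    by (simp add: algebra_simps)
  also have "(real n + 3) * y - real n * x = (real n + 2) * riordan (n + 1)"
    using B[of n] by (simp add: x_def y_def)
  also have "x - y = riordan n" by (simp add: riordan_eq x_def y_def)
  finally have "(real n + 2) * ((real n + 3) * riordan (n + 2)) =
      (real n + 2) * ((real n + 1) * (2 * riordan (n + 1) + 3 * riordan n))"
    by (simp add: algebra_simps)
  then show ?thesis by (subst (asm) mult_cancel_left) auto
qed

lemma riordan_nonneg: "riordan n \<ge> 0"
  by (simp add: riordan_def two_row_mult_nonneg)

lemma riordan_small:
  "riordan 0 = 1" "riordan 1 = 0" "riordan 2 = 1" "riordan 3 = 1" "riordan 4 = 3" "riordan 5 = 6"
proof -
  show 0: "riordan 0 = 1" "riordan 1 = 0" by (simp_all add: riordan_eq)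
  show 2: "riordan 2 = 1" using riordan_recurrence[of 0] 0 by (simp add: numeral_eq_Suc)
  show 3: "riordan 3 = 1" using riordan_recurrence[of 1] 0 2 by (simp add: numeral_eq_Suc)
  show 4: "riordan 4 = 3" using riordan_recurrence[of 2] 2 3 by (simp add: numeral_eq_Suc)
  show "riordan 5 = 6" using riordan_recurrence[of 3] 3 4 by (simp add: numeral_eq_Suc)
qed

text \<open>By the recurrence the claim at j + 2 is equivalent to
  \<open>riordan (j + 2) \<le> 3 * riordan (j + 1)\<close>, and the claim at j implies that. Hence
  the induction moves in steps of two from i = 3 and i = 4. The bound is an equality at i = 4 and
  false at i = 2.\<close>

lemma riordan_growth:
  assumes "i \<ge> 3"
  shows "(real i + 2) * riordan (Suc i) \<ge> 3 * real i * riordan i"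
  using assms
proof (induction i rule: less_induct)
  case (less i)
  consider "i = 3" | "i = 4" | "i \<ge> 5" using less.prems by linarith
  then show ?case
  proof cases
    case 3
    then obtain j where j: "i = j + 2" "j \<ge> 3" using that[of "i - 2"] by simp
    let ?a = "riordan j" and ?b = "riordan (j + 1)" and ?c = "riordan (j + 2)"
    have 1: "3 * real j * ?a \<le> (real j + 2) * ?b" using less.IH[of j] j by simp
    have 2: "(real j + 3) * ?c = (real j + 1) * (2 * ?b + 3 * ?a)" by (rule riordan_recurrence)
    have 3: "(real j + 4) * riordan (j + 3) = (real j + 2) * (2 * ?c + 3 * ?b)"
      using riordan_recurrence[of "j + 1"] by (simp add: algebra_simps numeral_eq_Suc)
    have "real j * ((real j + 3) * ?c) = (real j + 1) * (2 * real j * ?b + 3 * real j * ?a)"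
      unfolding 2 by (simp add: algebra_simps)
    also have "\<dots> \<le> (real j + 1) * (2 * real j * ?b + (real j + 2) * ?b)"
      using 1 by (intro mult_left_mono) auto
    also have "\<dots> = (real j + 1) * (3 * real j + 2) * ?b" by (simp add: algebra_simps)
    \<comment> \<open>After expansion this is 2 \<le> 4j.\<close>
    also have "\<dots> \<le> (real j * (real j + 3) * 3) * ?b"
      using j(2) riordan_nonneg by (intro mult_right_mono) (auto simp: algebra_simps)
    finally have "(real j * (real j + 3)) * ?c \<le> (real j * (real j + 3)) * (3 * ?b)"
      by (simp add: algebra_simps)
    then have "?c \<le> 3 * ?b" using j(2) by (subst (asm) mult_le_cancel_left_pos) auto
    then have "(real j + 2) * (3 * ?c) \<le> (real j + 2) * (2 * ?c + 3 * ?b)"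
      by (intro mult_left_mono) auto
    then show ?thesis using 3 j(1) by (simp add: algebra_simps numeral_eq_Suc)
  qed (use riordan_small in \<open>auto simp: numeral_eq_Suc\<close>)
qed

section \<open>The likelihood ratio order between the two multiplicity sequences\<close>

definition lr_below :: "nat \<Rightarrow> nat \<Rightarrow> bool" where
  "lr_below m i \<longleftrightarrow> (\<forall>k. 2 * k \<le> int (m + 2 * i) \<longrightarrow>
     two_row_mult m i k * ballot (m + 2 * i) (k - 1) \<le>
     two_row_mult m i (k - 1) * ballot (m + 2 * i) k)"

text \<open>The order is cross-multiplied because both sequences vanish at negative indices.
  Neighbouring comparisons chain to distant ones since the ballot number in between is strictly
  positive and can be cancelled.\<close>

lemma lr_belowD:
  assumes "lr_below m i" "2 * k \<le> int (m + 2 * i)" "j < k"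
  shows "two_row_mult m i k * ballot (m + 2 * i) j \<le> two_row_mult m i j * ballot (m + 2 * i) k"
  using assms(3,2)
proof (induction k rule: int_gr_induct)
  case base
  with assms(1) show ?case by (auto simp: lr_below_def dest: spec[of _ "j + 1"])
next
  case (step k)
  let ?u = "two_row_mult m i" and ?v = "ballot (m + 2 * i)"
  show ?case
  proof (cases "j < 0")
    case True
    then show ?thesis by (simp add: two_row_mult_neg)
  next
    case False
    have k: "?v k > 0" using step False by (intro ballot_pos) auto
    have 1: "?u (k + 1) * ?v k \<le> ?u k * ?v (k + 1)"
      using assms(1) step.prems by (auto simp: lr_below_def dest: spec[of _ "k + 1"])
    have 2: "?u k * ?v j \<le> ?u j * ?v k" using step by simp
    have "?v k * (?u (k + 1) * ?v j) = (?u (k + 1) * ?v k) * ?v j" by simp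
    also have "\<dots> \<le> (?u k * ?v (k + 1)) * ?v j"
      using 1 step by (intro mult_right_mono ballot_nonneg) auto
    also have "\<dots> = (?u k * ?v j) * ?v (k + 1)" by simp
    also have "\<dots> \<le> (?u j * ?v k) * ?v (k + 1)"
      using 2 step by (intro mult_right_mono ballot_nonneg) auto
    also have "\<dots> = ?v k * (?u j * ?v (k + 1))" by simp
    finally show ?thesis using k by simp
  qed
qed

text \<open>The kernel of tensoring with the two-dimensional representation of \<open>SU\<^sub>2\<close> is totally positive
  of order two, so it preserves the likelihood ratio order.\<close>

lemma lr_below_Suc:
  assumes "lr_below m i"
  shows "lr_below (Suc m) i"
  unfolding lr_below_def
proof (intro allI impI)
  fix k :: int
  assume k: "2 * k \<le> int (Suc m + 2 * i)"
  let ?u = "two_row_mult m i" and ?v = "ballot (m + 2 * i)"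
  \<comment> \<open>The range for m + 1 can contain one index outside the range for m. It is the
    centre of the old reflection, where both sequences vanish.\<close>
  have mid: "?u k = 0 \<and> ?v k = 0" if "2 * k = int (Suc m + 2 * i)"
    using two_row_mult_middle[of k m i] two_row_mult_middle[of k "m + 2 * i" 0] that by simp
  have k1: "?u k * ?v j \<le> ?u j * ?v k" if "j < k" for j
  proof (cases "2 * k = int (Suc m + 2 * i)")
    case True
    then show ?thesis using mid by simp
  next
    case False
    then show ?thesis using k that by (intro lr_belowD[OF assms]) auto
  qed
  have k2: "?u (k - 1) * ?v (k - 2) \<le> ?u (k - 2) * ?v (k - 1)"
    using k by (intro lr_belowD[OF assms]) auto
  show "two_row_mult (Suc m) i k * ballot (Suc m + 2 * i) (k - 1)
          \<le> two_row_mult (Suc m) i (k - 1) * ballot (Suc m + 2 * i) k"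
    using k1[of "k - 1"] k1[of "k - 2"] k2 by (simp add: two_row_mult_Suc algebra_simps)
qed

text \<open>Away from weight zero this is again total positivity, combined with the explicit ballot numbers.
  Total positivity fails at weight zero, because the trivial representation does not occur in
  \<open>V\<^sub>2 \<otimes> V\<^sub>0 = V\<^sub>2\<close>; there the growth of the Riordan numbers is used.\<close>

lemma lr_below_even_step:
  assumes i: "i \<ge> 3" and lr: "lr_below 0 i"
  shows "lr_below 0 (Suc i)"
  unfolding lr_below_def
proof (intro allI impI)
  fix k :: int
  assume k: "2 * k \<le> int (0 + 2 * Suc i)"
  let ?u = "two_row_mult 0 i" and ?v = "ballot (2 * i)"
  let ?M = "two_row_mult 0 (Suc i)" and ?B = "ballot (2 * i + 2)"
  \<comment> \<open>\<open>?N\<close> tensors the ballot sequence with V_2 only; \<open>?B\<close>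
    also contains the V_0 of V_1 tensor V_1, which is the extra term \<open>?v (k - 1)\<close>. Away
    from weight zero \<open>?M\<close> is compared with \<open>?N\<close>, and then
    \<open>?N\<close> with \<open>?B\<close>.\<close>
  let ?N = "\<lambda>k. ?v k + ?v (k - 1) + ?v (k - 2)"
  have B: "?B k = ?N k + ?v (k - 1)" for k
    by (simp add: two_row_mult_Suc numeral_eq_Suc algebra_simps)
  have "?M k * ?B (k - 1) \<le> ?M (k - 1) * ?B k"
  proof (cases "k = int (Suc i)")
    case True
    \<comment> \<open>The index k now has weight zero and k - 1 has weight two, so consecutive
      Riordan numbers are compared with the quotient in \<open>ballot_center\<close>.\<close>
    have 1: "?M (k - 1) = riordan (Suc (Suc i))" "?M k = riordan (Suc i)"
      using True riordan_Suc[of "Suc i"] by (simp_all add: riordan_def)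
    have 2: "(real i + 3) * ?B (k - 1) = 3 * (real i + 1) * ?B k"
      using ballot_center[of "Suc i"] True by (simp add: algebra_simps)
    have "(real i + 3) * (?M k * ?B (k - 1)) = (3 * (real i + 1) * riordan (Suc i)) * ?B k"
      using 1 2 by (simp add: algebra_simps)
    also have "\<dots> \<le> ((real i + 3) * riordan (Suc (Suc i))) * ?B k"
      using riordan_growth[of "Suc i"] i True
      by (intro mult_right_mono ballot_nonneg) (auto simp: algebra_simps)
    also have "\<dots> = (real i + 3) * (?M (k - 1) * ?B k)" using 1 by simp
    finally show ?thesis by (subst (asm) mult_le_cancel_left_pos) auto
  next
    case False
    with k have k': "k \<le> int i" by simp
    show ?thesis
    proof (cases "k \<le> 0")
      case True
      have "?B (k - 1) = 0" "?M (k - 1) = 0" using True by (auto intro: two_row_mult_neg)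
      then show ?thesis by simp
    next
      case False
      have uv: "?u a * ?v b \<le> ?u b * ?v a" if "b < a" "a \<le> k" for a b
        using lr_belowD[OF lr, of a b] that k' by simp
      have 1: "?M k * ?N (k - 1) \<le> ?M (k - 1) * ?N k"
        using uv[of "k - 1" k] uv[of "k - 2" k] uv[of "k - 3" k] uv[of "k - 3" "k - 1"] uv[of "k - 3" "k - 2"]
        by (simp add: two_row_mult_Suc_right algebra_simps)
      have v: "?v j \<ge> 0" if "j \<le> k" for j using that k' by (intro ballot_nonneg) auto
      have Bpos: "?B k > 0" "?B (k - 1) > 0" using False k' by (auto intro!: ballot_pos)
      define c where "c = (real (2 * i) + 2) * (real (2 * i) + 1)"
      have c: "c > 0" unfolding c_def by (intro mult_pos_pos) auto
      have r1: "c * ?v (k - 1) = of_int k * (real (2 * i) + 3 - of_int k) * ?B k"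
        unfolding c_def using False k' by (intro ballot_ratio) auto
      have r2: "c * ?v (k - 2) = (of_int k - 1) * (real (2 * i) + 4 - of_int k) * ?B (k - 1)"
        using ballot_ratio[of "k - 1" "2 * i"] False k' by (simp add: c_def algebra_simps)
      \<comment> \<open>The right side exceeds the left by 2i + 4 - 2k.\<close>
      have le: "(of_int k - 1) * (real (2 * i) + 4 - of_int k) \<le> of_int k * (real (2 * i) + 3 - of_int k)"
      proof -
        have "real_of_int k \<le> real i" using k' by linarith
        then show ?thesis by (simp add: algebra_simps)
      qed
      have "c * (?v (k - 2) * ?B k) = ((of_int k - 1) * (real (2 * i) + 4 - of_int k)) * (?B k * ?B (k - 1))"
        using r2 by (simp add: mult_ac)
      also have "\<dots> \<le> (of_int k * (real (2 * i) + 3 - of_int k)) * (?B k * ?B (k - 1))"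
        using le Bpos by (intro mult_right_mono) auto
      also have "\<dots> = c * (?v (k - 1) * ?B (k - 1))"
        using r1 by (simp add: mult_ac)
      finally have "?v (k - 2) * ?B k \<le> ?v (k - 1) * ?B (k - 1)"
        using c by simp
      then have 2: "?N k * ?B (k - 1) \<le> ?N (k - 1) * ?B k"
        using B[of k] B[of "k - 1"] by (simp add: algebra_simps)
      have N: "?N (k - 1) > 0"
        using ballot_pos[of "k - 1" "2 * i"] v[of "k - 2"] v[of "k - 3"] False k' by simp
      have M: "?M (k - 1) \<ge> 0" using k' by (intro two_row_mult_nonneg) auto
      have "?N (k - 1) * (?M k * ?B (k - 1)) = (?M k * ?N (k - 1)) * ?B (k - 1)" by simp
      also have "\<dots> \<le> (?M (k - 1) * ?N k) * ?B (k - 1)" using 1 Bpos by (intro mult_right_mono) auto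
      also have "\<dots> = ?M (k - 1) * (?N k * ?B (k - 1))" by simp
      also have "\<dots> \<le> ?M (k - 1) * (?N (k - 1) * ?B k)" using 2 M by (intro mult_left_mono)
      also have "\<dots> = ?N (k - 1) * (?M (k - 1) * ?B k)" by simp
      finally show ?thesis using N by (subst (asm) mult_le_cancel_left_pos)
    qed
  qed
  then show "?M k * ballot (0 + 2 * Suc i) (k - 1) \<le> ?M (k - 1) * ballot (0 + 2 * Suc i) k"
    by simp
qed

text \<open>Starting points, checked by computing finitely many values: the first two for the
  inductions on m with i = 1 and i = 2, the third for the induction on i with m = 0.\<close>

lemma lr_below_small: "lr_below 0 1" "lr_below 1 2" "lr_below 0 3"
proof -
  have *: "lr_below m i" if
    "\<And>k. k \<in> {1..int (m + 2 * i) div 2} \<Longrightarrow> two_row_mult m i k * ballot (m + 2 * i) (k - 1) \<le>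
     two_row_mult m i (k - 1) * ballot (m + 2 * i) k" for m i
    unfolding lr_below_def
  proof (intro allI impI)
    fix k assume k: "2 * k \<le> int (m + 2 * i)"
    show "two_row_mult m i k * ballot (m + 2 * i) (k - 1) \<le>
     two_row_mult m i (k - 1) * ballot (m + 2 * i) k"
    proof (cases "k \<le> 0")
      case True
      then show ?thesis by (simp add: two_row_mult_neg)
    next
      case False
      with k show ?thesis by (intro that) auto
    qed
  qed
  have s: "{1..1::int} = {1}" "{1..2::int} = {1, 2}" "{1..3::int} = {1, 2, 3}" by auto
  show "lr_below 0 1" "lr_below 1 2" "lr_below 0 3"
    by (rule *; auto simp: s numeral_eq_Suc two_row_mult_Suc two_row_mult_Suc_right two_row_mult_0_0)+
qed

text \<open>The ratios are not monotone for \<open>m = 0\<close>, \<open>i = 2\<close> (they are 1, 1/3, 1/2); this is where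
  \<open>n \<ge> 5\<close> is needed.\<close>

lemma lr_below_all:
  assumes "m + 2 * i \<ge> 5"
  shows "lr_below m i"
proof -
  have add: "lr_below (m + d) i" if "lr_below m i" for m d
    using that by (induction d) (auto intro: lr_below_Suc)
  have even: "lr_below 0 i" if "i \<ge> 3" for i
    using that by (induction i rule: dec_induct) (auto intro: lr_below_even_step lr_below_small)
  consider "i = 0" | "i = 1" | "i = 2" | "i \<ge> 3" by linarith
  then show ?thesis
  proof cases
    case 1
    then show ?thesis by (simp add: lr_below_def mult.commute)
  next
    case 2
    then show ?thesis using add[of 0 m] lr_below_small by simp
  next
    case 3
    with assms have "m = 1 + (m - 1)" by simp
    then show ?thesis using 3 add[of 1 "m - 1"] lr_below_small by metis
  next
    case 4
    then show ?thesis using add[of 0 m] even by simp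
  qed
qed

lemma two_row_ratio_antimono:
  assumes "m + 2 * i \<ge> 5" "k \<ge> 1" "2 * k \<le> m + 2 * i"
  shows "two_row_mult m i (int k) / ballot (m + 2 * i) (int k)
           \<le> two_row_mult m i (int k - 1) / ballot (m + 2 * i) (int k - 1)"
  using lr_belowD[OF lr_below_all[OF assms(1)], of "int k" "int k - 1"]
    ballot_pos[of "int k" "m + 2 * i"] ballot_pos[of "int k - 1" "m + 2 * i"] assms
  by (simp add: divide_simps)

section \<open>Matchings of trees\<close>

inductive leaf_tree :: "'v set \<Rightarrow> 'v set set \<Rightarrow> bool" where
  single: "leaf_tree {v} {}"
| add_leaf: "leaf_tree V E \<Longrightarrow> v \<in> V \<Longrightarrow> l \<notin> V \<Longrightarrow> leaf_tree (insert l V) (insert {l, v} E)"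

lemma leaf_tree_finite: "leaf_tree V E \<Longrightarrow> finite V \<and> finite E"
  by (induction rule: leaf_tree.induct) auto

lemma leaf_tree_edge_subset: "leaf_tree V E \<Longrightarrow> e \<in> E \<Longrightarrow> e \<subseteq> V"
  by (induction rule: leaf_tree.induct) auto

definition path_between :: "'v set set \<Rightarrow> 'v set \<Rightarrow> 'v \<Rightarrow> 'v \<Rightarrow> 'v list \<Rightarrow> bool" where
  "path_between E S a b p \<longleftrightarrow> p \<noteq> [] \<and> hd p = a \<and> last p = b \<and> distinct p \<and> set p \<subseteq> S \<and>
     (\<forall>i. Suc i < length p \<longrightarrow> {p ! i, p ! Suc i} \<in> E)"

lemma rtrancl_leaves_set:
  assumes "(s, u) \<in> R\<^sup>*" "s \<in> S" "u \<notin> S"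
  shows "\<exists>x y. (x, y) \<in> R \<and> x \<in> S \<and> y \<notin> S"
  using assms by (induction rule: rtrancl_induct) blast+

lemma graph_cycle_of_path:
  assumes p: "path_between E S x z p" and "x \<noteq> z" "y \<notin> S" "{y, x} \<in> E" "{y, z} \<in> E"
  shows "graph_cycle E (y # p)"
proof -
  from p have p': "p \<noteq> []" "hd p = x" "last p = z" "distinct p" "set p \<subseteq> S"
    "\<And>i. Suc i < length p \<Longrightarrow> {p ! i, p ! Suc i} \<in> E"
    by (auto simp: path_between_def)
  have len: "length p \<ge> 2"
    using p' \<open>x \<noteq> z\<close> by (cases p rule: remdups_adj.cases) auto
  have "{(y # p) ! i, (y # p) ! (Suc i mod length (y # p))} \<in> E" if "i < length (y # p)" for i
  proof (cases "i = length p")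
    case True
    then have "(y # p) ! i = z" using p' by (simp add: last_conv_nth nth_Cons')
    with True assms show ?thesis by (simp add: insert_commute)
  next
    case False
    then have m: "Suc i mod length (y # p) = Suc i" using that by simp
    show ?thesis
    proof (cases i)
      case 0
      then show ?thesis using m p' assms(4) by (simp add: hd_conv_nth)
    next
      case (Suc j)
      then show ?thesis using m p'(6)[of j] False that by simp
    qed
  qed
  then show ?thesis using len p' assms(3) by (auto simp: graph_cycle_def)
qed

lemma path_between_snoc:
  assumes "path_between E S a x p" "{y, x} \<in> E" "y \<notin> S"
  shows "path_between E (insert y S) a y (p @ [y])"
proof -
  have *: "{(p @ [y]) ! i, (p @ [y]) ! Suc i} \<in> E" if "Suc i < length (p @ [y])" for i
  proof (cases "Suc i = length p")
    case True
    then have "p ! i = x" using assms(1) by (metis path_between_def last_conv_nth diff_Suc_1)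
    with True assms(2) show ?thesis by (simp add: nth_append insert_commute)
  next
    case False
    with that assms(1) show ?thesis by (auto simp: nth_append path_between_def)
  qed
  show ?thesis using assms * unfolding path_between_def by (auto simp: hd_append)
qed

lemma path_between_rev:
  assumes "path_between E S a b p"
  shows "path_between E S b a (rev p)"
proof -
  have "{rev p ! i, rev p ! Suc i} \<in> E" if "Suc i < length p" for i
  proof -
    define j where "j = length p - Suc (Suc i)"
    have "{p ! j, p ! Suc j} \<in> E" using assms that by (auto simp: path_between_def j_def)
    moreover have "rev p ! i = p ! Suc j" "rev p ! Suc i = p ! j"
      using that by (auto simp: rev_nth j_def Suc_diff_Suc)
    ultimately show ?thesis by (simp add: insert_commute)
  qed
  then show ?thesis using assms by (auto simp: path_between_def hd_rev last_rev)
qed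

text \<open>A vertex set S is grown one vertex at a time. Connectedness supplies an edge from S to
  some y outside. A second edge from y into S would close a cycle with a path inside S, so y is a
  leaf of the graph induced on the larger set. The invariant therefore carries simple paths between
  any two vertices of S.\<close>

lemma is_tree_imp_leaf_tree:
  assumes "is_tree V E"
  shows "leaf_tree V E"
proof -
  have fin: "finite V" and edge: "\<And>e. e \<in> E \<Longrightarrow> e \<subseteq> V \<and> card e = 2" and ne: "V \<noteq> {}"
    and conn: "\<And>u v. u \<in> V \<Longrightarrow> v \<in> V \<Longrightarrow> (u, v) \<in> {(x, y). {x, y} \<in> E}\<^sup>*"
    and acyc: "\<And>c. \<not> graph_cycle E c"
    using assms by (auto simp: is_tree_def simple_graph_def connected_graph_def)
  have grow: "\<exists>S\<subseteq>V. card S = Suc m \<and> leaf_tree S {e \<in> E. e \<subseteq> S} \<and>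
          (\<forall>a\<in>S. \<forall>b\<in>S. \<exists>p. path_between E S a b p)" if "Suc m \<le> card V" for m
    using that
  proof (induction m)
    case 0
    obtain v where v: "v \<in> V" using ne by auto
    have "\<not> e \<subseteq> {v}" if "e \<in> E" for e
      using card_mono[of "{v}" e] edge[OF that] by auto
    then have "{e \<in> E. e \<subseteq> {v}} = {}" by blast
    then have "leaf_tree {v} {e \<in> E. e \<subseteq> {v}}" by (metis leaf_tree.single)
    moreover have "path_between E {v} v v [v]" by (simp add: path_between_def)
    ultimately show ?case using v by (intro exI[of _ "{v}"]) auto
  next
    case (Suc m)
    then obtain S where S: "S \<subseteq> V" "card S = Suc m" "leaf_tree S {e \<in> E. e \<subseteq> S}"
      and paths: "\<And>a b. a \<in> S \<Longrightarrow> b \<in> S \<Longrightarrow> \<exists>p. path_between E S a b p" by auto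
    obtain s where s: "s \<in> S" using S(2) by fastforce
    obtain u where u: "u \<in> V" "u \<notin> S" using S(1,2) Suc.prems by (metis Suc_n_not_le_n subsetI subset_antisym)
    obtain x y where xy: "{x, y} \<in> E" "x \<in> S" "y \<notin> S"
      using rtrancl_leaves_set[OF conn[of s u] s u(2)] s u S(1) by auto
    have yx: "{y, x} \<in> E" using xy by (simp add: insert_commute)
    have yV: "y \<in> V" using edge[OF xy(1)] by simp
    have "e = {y, x}" if e: "e \<in> E" "e \<subseteq> insert y S" "\<not> e \<subseteq> S" for e
    proof -
      obtain a b where ab: "e = {a, b}" "a \<noteq> b" using edge[OF e(1)] by (auto simp: card_2_iff)
      then obtain z where z: "e = {y, z}" "z \<in> S" using e by auto
      obtain p where p: "path_between E S x z p" using paths xy(2) z(2) by blast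
      show ?thesis
      proof (rule ccontr)
        assume "e \<noteq> {y, x}"
        then have "x \<noteq> z" using z by auto
        then show False using graph_cycle_of_path[OF p _ xy(3) yx] z e acyc by blast
      qed
    qed
    then have E': "{e \<in> E. e \<subseteq> insert y S} = insert {y, x} {e \<in> E. e \<subseteq> S}"
      using yx xy by auto
    have "leaf_tree (insert y S) {e \<in> E. e \<subseteq> insert y S}"
      unfolding E' using S xy by (intro leaf_tree.add_leaf) auto
    moreover have "\<exists>p. path_between E (insert y S) a b p" if ab: "a \<in> insert y S" "b \<in> insert y S" for a b
    proof -
      have mono: "path_between E (insert y S) a b p" if "path_between E S a b p" for a b p
        using that by (auto simp: path_between_def)
      have to_y: "\<exists>p. path_between E (insert y S) a y p" if a: "a \<in> S" for a
        using path_between_snoc[OF _ yx xy(3)] paths[OF a xy(2)] by blast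
      have yy: "path_between E (insert y S) y y [y]" by (simp add: path_between_def)
      show ?thesis
      proof (cases "b = y")
        case True
        then show ?thesis using ab to_y yy by auto
      next
        case False
        then have b: "b \<in> S" using ab by simp
        show ?thesis
        proof (cases "a = y")
          case True
          then show ?thesis using to_y[OF b] by (metis path_between_rev)
        next
          case False
          then show ?thesis using ab b paths mono by blast
        qed
      qed
    qed
    moreover have "card (insert y S) = Suc (Suc m)"
      using S xy(3) finite_subset[OF S(1) fin] by simp
    ultimately show ?case using S(1) yV by (intro exI[of _ "insert y S"]) auto
  qed
  have "card V > 0" using ne fin by (simp add: card_gt_0_iff)
  then obtain S where S: "S \<subseteq> V" "card S = card V" "leaf_tree S {e \<in> E. e \<subseteq> S}"
    using grow[of "card V - 1"] by auto
  then have "S = V" using fin card_subset_eq by blast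
  moreover have "{e \<in> E. e \<subseteq> V} = E" using edge by auto
  ultimately show ?thesis using S by simp
qed

section \<open>Permutations that move vertices only along edges, i.e. matchings in a tree\<close>

definition graph_perms :: "'v set \<Rightarrow> 'v set set \<Rightarrow> ('v \<Rightarrow> 'v) set" where
  "graph_perms V E = {\<pi>. \<pi> permutes V \<and> (\<forall>v\<in>V. \<pi> v \<noteq> v \<longrightarrow> {v, \<pi> v} \<in> E)}"

lemma finite_graph_perms: "finite V \<Longrightarrow> finite (graph_perms V E)"
  unfolding graph_perms_def by (rule finite_subset[OF _ finite_permutations[of V]]) auto

text \<open>The only neighbour of l is v, so a permutation moving l has v as both the image and the
  preimage of l; removing this transposition leaves a permutation of the old tree that fixes
  v.\<close>

lemma graph_perms_add_leaf:
  assumes EV: "\<And>e. e \<in> E \<Longrightarrow> e \<subseteq> V" and v: "v \<in> V" and l: "l \<notin> V"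
  shows "graph_perms (insert l V) (insert {l, v} E) =
           graph_perms V E \<union> (\<lambda>\<pi>. transpose l v \<circ> \<pi>) ` {\<pi> \<in> graph_perms V E. \<pi> v = v}"
    (is "?L = ?A \<union> ?B")
proof (intro equalityI subsetI)
  fix \<pi> assume "\<pi> \<in> ?L"
  then have p: "\<pi> permutes insert l V"
    and e: "\<And>u. u \<in> insert l V \<Longrightarrow> \<pi> u \<noteq> u \<Longrightarrow> {u, \<pi> u} \<in> insert {l, v} E"
    by (auto simp: graph_perms_def)
  have lE: "{l, x} \<notin> E" "{x, l} \<notin> E" for x using EV l by auto
  have vl: "v \<noteq> l" using v l by auto
  show "\<pi> \<in> ?A \<union> ?B"
  proof (cases "\<pi> l = l")
    case True
    have "\<pi> permutes V" using True by (intro permutes_superset[OF p]) auto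
    moreover have "{u, \<pi> u} \<in> E" if u: "u \<in> V" "\<pi> u \<noteq> u" for u
    proof -
      have "\<pi> u \<noteq> l" using True permutes_inj[OF p] u l by (metis injD)
      then show ?thesis using e[of u] u l by (auto simp: doubleton_eq_iff)
    qed
    ultimately show ?thesis by (auto simp: graph_perms_def)
  next
    case False
    have "{l, \<pi> l} \<in> insert {l, v} E" using e False by blast
    then have pl: "\<pi> l = v" using lE by (auto simp: doubleton_eq_iff)
    obtain w where w: "\<pi> w = l" using permutes_surj[OF p] by (metis surjD)
    have "w \<noteq> l" using w False by auto
    moreover have "w \<in> insert l V" using w p l by (metis insertI1 permutes_not_in)
    ultimately have "{w, l} \<in> insert {l, v} E" using e[of w] w by auto
    then have "w = v" using lE \<open>w \<noteq> l\<close> by (auto simp: doubleton_eq_iff)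
    then have pv: "\<pi> v = l" using w by simp
    define \<sigma> where "\<sigma> = transpose l v \<circ> \<pi>"
    have s: "\<sigma> permutes insert l V" unfolding \<sigma>_def
      using p v by (intro permutes_compose[OF p] permutes_swap_id) auto
    have sl: "\<sigma> l = l" "\<sigma> v = v" using pl pv by (auto simp: \<sigma>_def)
    have sV: "\<sigma> permutes V" using sl by (intro permutes_superset[OF s]) auto
    have "{u, \<sigma> u} \<in> E" if u: "u \<in> V" "\<sigma> u \<noteq> u" for u
    proof -
      have "u \<noteq> v" "u \<noteq> l" using u sl l by auto
      then have "\<pi> u \<noteq> l" "\<pi> u \<noteq> v" using pl pv permutes_inj[OF p] by (metis injD)+
      then have "\<sigma> u = \<pi> u" by (simp add: \<sigma>_def transpose_def)
      then show ?thesis using e[of u] u \<open>u \<noteq> l\<close> \<open>\<pi> u \<noteq> l\<close> by (auto simp: doubleton_eq_iff)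
    qed
    then have "\<sigma> \<in> {\<pi> \<in> graph_perms V E. \<pi> v = v}" using sV sl by (auto simp: graph_perms_def)
    moreover have "\<pi> = transpose l v \<circ> \<sigma>" by (simp add: \<sigma>_def o_assoc[symmetric] fun_eq_iff)
    ultimately show ?thesis by blast
  qed
next
  fix \<pi> assume "\<pi> \<in> ?A \<union> ?B"
  then show "\<pi> \<in> ?L"
  proof
    assume "\<pi> \<in> ?A"
    then show ?thesis
      using l by (auto simp: graph_perms_def permutes_not_in intro: permutes_subset)
  next
    assume "\<pi> \<in> ?B"
    then obtain \<sigma> where s: "\<sigma> permutes V" "\<And>u. u \<in> V \<Longrightarrow> \<sigma> u \<noteq> u \<Longrightarrow> {u, \<sigma> u} \<in> E" "\<sigma> v = v"
      and \<pi>: "\<pi> = transpose l v \<circ> \<sigma>" by (auto simp: graph_perms_def)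
    have "\<pi> permutes insert l V" unfolding \<pi>
      using v by (intro permutes_compose[OF permutes_subset[OF s(1)]] permutes_swap_id) auto
    moreover have "{u, \<pi> u} \<in> insert {l, v} E" if u: "u \<in> insert l V" "\<pi> u \<noteq> u" for u
    proof -
      have sl: "\<sigma> l = l" using s(1) l by (rule permutes_not_in)
      consider "u = l" | "u = v" | "u \<noteq> l" "u \<noteq> v" by blast
      then show ?thesis
      proof cases
        case 3
        then have "\<sigma> u \<noteq> l" "\<sigma> u \<noteq> v" using sl s(3) permutes_inj[OF s(1)] by (metis injD)+
        then have "\<pi> u = \<sigma> u" by (simp add: \<pi> transpose_def)
        then show ?thesis using s(2)[of u] u 3 by auto
      qed (use sl s(3) in \<open>auto simp: \<pi> insert_commute\<close>)
    qed
    ultimately show ?thesis by (auto simp: graph_perms_def)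
  qed
qed

text \<open>Each new leaf is either fixed or swapped with a vertex that the rest of the permutation
  fixes, so no cycle longer than two can arise.\<close>

lemma graph_perms_involution:
  assumes "leaf_tree V E" "\<pi> \<in> graph_perms V E"
  shows "\<pi> (\<pi> u) = u"
  using assms
proof (induction arbitrary: \<pi> u rule: leaf_tree.induct)
  case (single v)
  then show ?case by (simp add: graph_perms_def)
next
  case (add_leaf V E v l)
  have dec: "\<pi> \<in> graph_perms V E \<union> (\<lambda>\<pi>. transpose l v \<circ> \<pi>) ` {\<pi> \<in> graph_perms V E. \<pi> v = v}"
    using add_leaf.prems graph_perms_add_leaf[OF leaf_tree_edge_subset[OF add_leaf.hyps(1)] add_leaf.hyps(2,3)]
    by simp
  then show ?case
  proof
    assume "\<pi> \<in> (\<lambda>\<pi>. transpose l v \<circ> \<pi>) ` {\<pi> \<in> graph_perms V E. \<pi> v = v}"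
    then obtain \<sigma> where s: "\<sigma> \<in> graph_perms V E" "\<sigma> v = v" and \<pi>: "\<pi> = transpose l v \<circ> \<sigma>" by auto
    have inv: "\<sigma> (\<sigma> x) = x" for x using add_leaf.IH s by blast
    have sl: "\<sigma> l = l" using s add_leaf.hyps(3) by (auto simp: graph_perms_def permutes_not_in)
    have "\<sigma> u = l \<longleftrightarrow> u = l" "\<sigma> u = v \<longleftrightarrow> u = v" using inv sl s(2) by metis+
    then show ?thesis using sl s(2) inv by (auto simp: \<pi> transpose_def)
  qed (use add_leaf.IH in blast)
qed

section \<open>Weighted matching sums and the contraction of a leaf\<close>

definition matching_sum ::
  "'a::comm_ring_1 \<Rightarrow> ('v \<Rightarrow> 'a) \<Rightarrow> ('v \<Rightarrow> 'a) \<Rightarrow> 'v set \<Rightarrow> 'v set set \<Rightarrow> 'a" where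
  "matching_sum w x y V E = (\<Sum>\<pi>\<in>graph_perms V E.
     w ^ (card {u \<in> V. \<pi> u \<noteq> u} div 2) * (\<Prod>u\<in>V. if \<pi> u = u then x u else y u))"

lemma matching_sum_cong:
  assumes "\<And>u. u \<in> V \<Longrightarrow> x u = x' u" "\<And>u. u \<in> V \<Longrightarrow> y u = y' u"
  shows "matching_sum w x y V E = matching_sum w x' y' V E"
  unfolding matching_sum_def using assms
  by (intro sum.cong refl arg_cong2[where f = "(*)"] prod.cong) auto

text \<open>If v is matched inside the old tree, then l is unmatched and multiplies the weight by
  \<open>x l\<close>. If not, either both are unmatched or they are matched to each other, and the
  two terms add up to the new weight of an unmatched v. Matched vertices need a weight
  \<open>y\<close> of their own because contraction changes it.\<close>

lemma matching_sum_add_leaf: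
  assumes fin: "finite V" and EV: "\<And>e. e \<in> E \<Longrightarrow> e \<subseteq> V" and v: "v \<in> V" and l: "l \<notin> V"
  shows "matching_sum w x y (insert l V) (insert {l, v} E) =
           matching_sum w (x(v := x v * x l + w * y v * y l)) (y(v := y v * x l)) V E"
proof -
  let ?G = "graph_perms V E" and ?\<tau> = "\<lambda>\<pi>. transpose l v \<circ> \<pi>"
  let ?G' = "{\<pi> \<in> ?G. \<pi> v = v}"
  let ?T = "\<lambda>\<pi>. w ^ (card {u \<in> insert l V. \<pi> u \<noteq> u} div 2) *
     (\<Prod>u\<in>insert l V. if \<pi> u = u then x u else y u)"
  let ?R = "\<lambda>\<pi>. w ^ (card {u \<in> V. \<pi> u \<noteq> u} div 2) * (\<Prod>u\<in>V - {v}. if \<pi> u = u then x u else y u)"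
  have fG: "finite ?G" using fin by (rule finite_graph_perms)
  have vl: "v \<noteq> l" using v l by auto
  have fix_l: "\<pi> l = l" if "\<pi> \<in> ?G" for \<pi> using that l by (auto simp: graph_perms_def permutes_not_in)
  have inj: "inj_on ?\<tau> ?G'"
  proof (rule inj_onI)
    fix \<pi> \<sigma> assume "?\<tau> \<pi> = ?\<tau> \<sigma>"
    then have "transpose l v (\<pi> u) = transpose l v (\<sigma> u)" for u by (simp add: fun_eq_iff)
    then show "\<pi> = \<sigma>" by (metis ext transpose_involutory)
  qed
  have disj: "?G \<inter> ?\<tau> ` ?G' = {}"
  proof -
    have "?\<tau> \<pi> \<notin> ?G" if "\<pi> \<in> ?G'" for \<pi>
      using that fix_l[of "?\<tau> \<pi>"] fix_l[of \<pi>] vl by auto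
    then show ?thesis by blast
  qed
  have T1: "?T \<pi> = (if \<pi> v = v then x v * x l else y v * x l) * ?R \<pi>" if "\<pi> \<in> ?G" for \<pi>
  proof -
    have "{u \<in> insert l V. \<pi> u \<noteq> u} = {u \<in> V. \<pi> u \<noteq> u}" using fix_l[OF that] by auto
    then show ?thesis using fix_l[OF that] fin l prod.remove[OF fin v, of "\<lambda>u. if \<pi> u = u then x u else y u"]
      by (simp add: mult_ac)
  qed
  have T2: "?T (?\<tau> \<pi>) = w * y v * y l * ?R \<pi>" if "\<pi> \<in> ?G'" for \<pi>
  proof -
    have pl: "\<pi> l = l" and pv: "\<pi> v = v" and perm: "\<pi> permutes V"
      using that fix_l by (auto simp: graph_perms_def)
    have same: "?\<tau> \<pi> u = \<pi> u" if "u \<noteq> l" "u \<noteq> v" for u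
    proof -
      have "\<pi> u \<noteq> l" "\<pi> u \<noteq> v" using that pl pv permutes_inj[OF perm] by (metis injD)+
      then show ?thesis by simp
    qed
    have "{u \<in> insert l V. ?\<tau> \<pi> u \<noteq> u} = insert l (insert v {u \<in> V. \<pi> u \<noteq> u})"
    proof (intro equalityI subsetI)
      fix u assume "u \<in> {u \<in> insert l V. ?\<tau> \<pi> u \<noteq> u}"
      then show "u \<in> insert l (insert v {u \<in> V. \<pi> u \<noteq> u})" using same[of u] by auto
    next
      fix u assume u: "u \<in> insert l (insert v {u \<in> V. \<pi> u \<noteq> u})"
      show "u \<in> {u \<in> insert l V. ?\<tau> \<pi> u \<noteq> u}"
      proof (cases "u = l \<or> u = v")
        case True
        then show ?thesis using pl pv v vl by auto
      next
        case False
        then show ?thesis using same[of u] u by auto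
      qed
    qed
    then have c: "card {u \<in> insert l V. ?\<tau> \<pi> u \<noteq> u} = card {u \<in> V. \<pi> u \<noteq> u} + 2"
      using fin l pl pv vl by simp
    have "(\<Prod>u\<in>insert l V. if ?\<tau> \<pi> u = u then x u else y u)
        = y l * (y v * (\<Prod>u\<in>V - {v}. if ?\<tau> \<pi> u = u then x u else y u))"
      using fin l vl pl pv prod.remove[OF fin v, of "\<lambda>u. if ?\<tau> \<pi> u = u then x u else y u"] by simp
    also have "(\<Prod>u\<in>V - {v}. if ?\<tau> \<pi> u = u then x u else y u) = (\<Prod>u\<in>V - {v}. if \<pi> u = u then x u else y u)"
    proof (rule prod.cong[OF refl])
      fix u assume "u \<in> V - {v}"
      then have "?\<tau> \<pi> u = \<pi> u" using l by (intro same) auto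
      then show "(if ?\<tau> \<pi> u = u then x u else y u) = (if \<pi> u = u then x u else y u)" by simp
    qed
    finally show ?thesis unfolding c by (simp add: mult_ac)
  qed
  have "matching_sum w x y (insert l V) (insert {l, v} E) = sum ?T (?G \<union> ?\<tau> ` ?G')"
    by (simp only: matching_sum_def graph_perms_add_leaf[OF EV v l])
  also have "\<dots> = sum ?T ?G + sum ?T (?\<tau> ` ?G')"
    using fG disj by (intro sum.union_disjoint) auto
  also have "sum ?T (?\<tau> ` ?G') = (\<Sum>\<pi>\<in>?G'. ?T (?\<tau> \<pi>))"
    using inj by (subst sum.reindex) auto
  also have "\<dots> = (\<Sum>\<pi>\<in>?G'. w * y v * y l * ?R \<pi>)" by (intro sum.cong refl T2)
  also have "\<dots> = (\<Sum>\<pi>\<in>?G. if \<pi> v = v then w * y v * y l * ?R \<pi> else 0)"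
    using fG by (simp add: sum.inter_filter)
  also have "sum ?T ?G + \<dots> = (\<Sum>\<pi>\<in>?G. (if \<pi> v = v then x v * x l + w * y v * y l else y v * x l) * ?R \<pi>)"
    unfolding sum.distrib[symmetric]
  proof (intro sum.cong refl)
    fix \<pi> assume "\<pi> \<in> ?G"
    show "?T \<pi> + (if \<pi> v = v then w * y v * y l * ?R \<pi> else 0) =
        (if \<pi> v = v then x v * x l + w * y v * y l else y v * x l) * ?R \<pi>"
      unfolding T1[OF \<open>\<pi> \<in> ?G\<close>] by (simp add: distrib_right)
  qed
  also have "\<dots> = matching_sum w (x(v := x v * x l + w * y v * y l)) (y(v := y v * x l)) V E"
    unfolding matching_sum_def
  proof (intro sum.cong refl)
    fix \<pi>
    let ?x = "x(v := x v * x l + w * y v * y l)" and ?y = "y(v := y v * x l)"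
    have "(\<Prod>u\<in>V - {v}. if \<pi> u = u then ?x u else ?y u) = (\<Prod>u\<in>V - {v}. if \<pi> u = u then x u else y u)"
      by (intro prod.cong) auto
    then show "(if \<pi> v = v then x v * x l + w * y v * y l else y v * x l) * ?R \<pi> =
        w ^ (card {u \<in> V. \<pi> u \<noteq> u} div 2) * (\<Prod>u\<in>V. if \<pi> u = u then ?x u else ?y u)"
      using prod.remove[OF fin v, of "\<lambda>u. if \<pi> u = u then ?x u else ?y u"] by (simp add: mult_ac)
  qed
  finally show ?thesis .
qed

section \<open>Coefficientwise positivity of the matching polynomial\<close>

definition nonneg_poly :: "real poly \<Rightarrow> bool" where
  "nonneg_poly p \<longleftrightarrow> (\<forall>i. coeff p i \<ge> 0)"

lemma nonneg_poly_add: "nonneg_poly p \<Longrightarrow> nonneg_poly q \<Longrightarrow> nonneg_poly (p + q)"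
  by (simp add: nonneg_poly_def)

lemma nonneg_poly_mult: "nonneg_poly p \<Longrightarrow> nonneg_poly q \<Longrightarrow> nonneg_poly (p * q)"
  by (auto simp: nonneg_poly_def coeff_mult intro!: sum_nonneg)

lemma nonneg_poly_pCons: "a \<ge> 0 \<Longrightarrow> nonneg_poly p \<Longrightarrow> nonneg_poly (pCons a p)"
  by (auto simp: nonneg_poly_def coeff_pCons split: nat.split)

lemma nonneg_poly_0: "nonneg_poly 0"
  by (simp add: nonneg_poly_def)

lemma nonneg_poly_1: "nonneg_poly 1"
  by (simp add: nonneg_poly_def coeff_1)

text \<open>With the degree \<open>d\<close> of a vertex in the current tree, a vertex weighs \<open>Q + d T Y\<close> if it is
  unmatched and \<open>Y\<close> if it is matched.  Contracting a leaf into its neighbour preserves this shape and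
  the three inequalities.\<close>

definition leaf_weights :: "real poly \<Rightarrow> real poly \<Rightarrow> real poly \<Rightarrow> bool" where
  "leaf_weights T Q Y \<longleftrightarrow>
     nonneg_poly (Y - 1) \<and> nonneg_poly (Q - (1 - T)) \<and> nonneg_poly (Q + T * Y - Y)"

text \<open>A leaf has degree 1, so \<open>F\<close> is its unmatched weight. Contraction with edge
  weight \<open>T * (Z - 1)\<close> lowers the degree of v by one; splitting off the remaining
  degree times \<open>T * (Y * F)\<close> leaves the stated new \<open>Q\<close>. The third
  inequality for the leaf, \<open>F - Yl\<close>, absorbs the negative term of \<open>Z - 1\<close>
  and makes \<open>D\<close> nonnegative. The bound on \<open>Q\<close> is relative to
  \<open>1 - T\<close> because 1 - t may be negative.\<close>

lemma leaf_weights_add_leaf: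
  assumes T: "nonneg_poly T" and Z: "nonneg_poly Z"
    and v: "leaf_weights T Q Y" and l: "leaf_weights T Ql Yl"
  defines "F \<equiv> Ql + T * Yl"
  shows "leaf_weights T (Q * F + T * (F + (Z - 1) * Yl) * Y) (Y * F)"
proof -
  have Y1: "nonneg_poly (Y - 1)" and Q1: "nonneg_poly (Q - (1 - T))" and H: "nonneg_poly (Q + T * Y - Y)"
    using v by (auto simp: leaf_weights_def)
  have Yl1: "nonneg_poly (Yl - 1)" and Ql1: "nonneg_poly (Ql - (1 - T))" and Hl: "nonneg_poly (F - Yl)"
    using l by (auto simp: leaf_weights_def F_def)
  have Y: "nonneg_poly Y" and Yl: "nonneg_poly Yl"
    using nonneg_poly_add[OF Y1 nonneg_poly_1] nonneg_poly_add[OF Yl1 nonneg_poly_1] by simp_all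
  have F1: "nonneg_poly (F - 1)"
    using nonneg_poly_add[OF Hl Yl1] by simp
  have F: "nonneg_poly F" using nonneg_poly_add[OF F1 nonneg_poly_1] by simp
  define D where "D = F + (Z - 1) * Yl"
  have "D = (F - Yl) + Z * Yl" by (simp add: D_def algebra_simps)
  then have D: "nonneg_poly D" using Hl Z Yl by (simp only: nonneg_poly_add nonneg_poly_mult)
  have "nonneg_poly (Y * F - 1)"
  proof -
    have "Y * F - 1 = (Y - 1) * F + (F - 1)" by (simp add: algebra_simps)
    then show ?thesis using Y1 F F1 by (simp only: nonneg_poly_add nonneg_poly_mult)
  qed
  moreover have "nonneg_poly (Q * F + T * D * Y - (1 - T))"
  proof -
    \<comment> \<open>This rests on \<open>(1 - T) * F + T * D = Ql + T * Z * Yl\<close>: the leaf's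
      own bound supplies the \<open>1 - T\<close> to be subtracted.\<close>
    have "Q * F + T * D * Y - (1 - T) =
        (Q - (1 - T)) * F + T * D * (Y - 1) + (Ql - (1 - T)) + T * Z * Yl"
      by (simp add: D_def F_def algebra_simps)
    then show ?thesis using Q1 F T D Y1 Ql1 Z Yl by (simp only: nonneg_poly_add nonneg_poly_mult)
  qed
  moreover have "nonneg_poly (Q * F + T * D * Y + T * (Y * F) - Y * F)"
  proof -
    have "Q * F + T * D * Y + T * (Y * F) - Y * F = (Q + T * Y - Y) * F + T * D * Y"
      by (simp add: algebra_simps)
    then show ?thesis using H F T D Y by (simp only: nonneg_poly_add nonneg_poly_mult)
  qed
  ultimately show ?thesis by (simp add: leaf_weights_def D_def)
qed

text \<open>Contracting leaves ends at a single vertex of degree 0, whose sum is its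
  \<open>Q\<close>; the second inequality of \<open>leaf_weights\<close> is then the claim.\<close>

lemma matching_sum_nonneg:
  assumes T: "nonneg_poly T" and Z: "nonneg_poly Z"
    and tree: "leaf_tree V E" and w: "\<And>v. v \<in> V \<Longrightarrow> leaf_weights T (Q v) (Y v)"
  shows "nonneg_poly (matching_sum (T * (Z - 1))
           (\<lambda>v. Q v + T * of_nat (card {e \<in> E. v \<in> e}) * Y v) Y V E - (1 - T))"
  using tree w
proof (induction arbitrary: Q Y rule: leaf_tree.induct)
  case (single v)
  have "graph_perms {v} {} = {id}" by (auto simp: graph_perms_def)
  with single show ?case by (simp add: matching_sum_def leaf_weights_def)
next
  case (add_leaf V E v l)
  have fin: "finite V" "finite E" using leaf_tree_finite[OF add_leaf.hyps(1)] by auto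
  have EV: "e \<subseteq> V" if "e \<in> E" for e using leaf_tree_edge_subset[OF add_leaf.hyps(1) that] .
  let ?E = "insert {l, v} E"
  define d where "d F u = card {e \<in> F. u \<in> e}" for F and u :: 'a
  let ?x = "\<lambda>u. Q u + T * of_nat (d ?E u) * Y u"
  let ?F = "Q l + T * Y l"
  let ?Q = "Q(v := Q v * ?F + T * (?F + (Z - 1) * Y l) * Y v)" and ?Y = "Y(v := Y v * ?F)"
  have lv: "{l, v} \<notin> E" using EV add_leaf.hyps(3) by auto
  have "{e \<in> ?E. l \<in> e} = {{l, v}}" using EV add_leaf.hyps(3) by auto
  then have dl: "d ?E l = 1" by (simp add: d_def)
  have "{e \<in> ?E. v \<in> e} = insert {l, v} {e \<in> E. v \<in> e}" by auto
  then have dv: "d ?E v = Suc (d E v)" using lv fin by (simp add: d_def)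
  have du: "d ?E u = d E u" if "u \<in> V" "u \<noteq> v" for u
  proof -
    have "{e \<in> ?E. u \<in> e} = {e \<in> E. u \<in> e}" using that add_leaf.hyps(3) by auto
    then show ?thesis by (simp add: d_def)
  qed
  have xl: "?x l = ?F" using dl by simp
  have "leaf_weights T (?Q u) (?Y u)" if "u \<in> V" for u
    using leaf_weights_add_leaf[OF T Z add_leaf.prems[of v] add_leaf.prems[of l]]
      add_leaf.prems[of u] that add_leaf.hyps(2) by auto
  then have IH: "nonneg_poly (matching_sum (T * (Z - 1)) (\<lambda>v. ?Q v + T * of_nat (d E v) * ?Y v) ?Y V E - (1 - T))"
    unfolding d_def by (rule add_leaf.IH)
  have "matching_sum (T * (Z - 1)) ?x Y (insert l V) ?E =
      matching_sum (T * (Z - 1)) (?x(v := ?x v * ?x l + (T * (Z - 1)) * Y v * Y l)) (Y(v := Y v * ?x l)) V E"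
    by (rule matching_sum_add_leaf[OF fin(1) EV add_leaf.hyps(2,3)])
  also have "\<dots> = matching_sum (T * (Z - 1)) (\<lambda>v. ?Q v + T * of_nat (d E v) * ?Y v) ?Y V E"
  proof (rule matching_sum_cong)
    fix u assume u: "u \<in> V"
    show "(?x(v := ?x v * ?x l + (T * (Z - 1)) * Y v * Y l)) u = ?Q u + T * of_nat (d E u) * ?Y u"
    proof (cases "u = v")
      case True
      then show ?thesis unfolding xl by (simp add: dv algebra_simps)
    next
      case False
      then show ?thesis using du[OF u False] by simp
    qed
  qed (simp add: xl)
  finally show ?case using IH by (simp add: d_def)
qed

text \<open>The product of the Laplacian entries along \<pi> with t = q^2: each matched edge
  contributes (-q)^2.\<close>

definition matching_weight :: "real \<Rightarrow> 'v set \<Rightarrow> 'v set set \<Rightarrow> ('v \<Rightarrow> 'v) \<Rightarrow> real" where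
  "matching_weight t V E \<pi> = t ^ (card {u \<in> V. \<pi> u \<noteq> u} div 2) *
     (\<Prod>u\<in>V. if \<pi> u = u then 1 + t * (real (card {e \<in> E. u \<in> e}) - 1) else 1)"

text \<open>The \<open>b i\<close> are the coefficients in z of the sum of the weights times (z -
  1)^j. Applying the linear functional (z - 1)^j |-> h j and writing z = 1 + (z - 1) gives the
  binomial sums. As \<open>h\<close> is arbitrary, one \<open>b\<close> serves both shapes of the
  theorem.\<close>

lemma matching_expansion:
  fixes t :: real
  assumes tree: "leaf_tree V E" and t: "t \<ge> 0"
  obtains b :: "nat \<Rightarrow> real" where "\<And>i. i \<ge> 1 \<Longrightarrow> b i \<ge> 0"
    and "\<And>h :: nat \<Rightarrow> real. (\<Sum>\<pi>\<in>graph_perms V E. h (card {u \<in> V. \<pi> u \<noteq> u} div 2) * matching_weight t V E \<pi>)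
           = (\<Sum>i\<le>card V div 2. b i * (\<Sum>j\<le>i. real (i choose j) * h j))"
proof
  let ?c = "\<lambda>u. 1 + t * (real (card {e \<in> E. u \<in> e}) - 1)"
  let ?j = "\<lambda>\<pi>. card {u \<in> V. \<pi> u \<noteq> u} div 2"
  let ?G = "graph_perms V E"
  define A where "A = (\<Sum>\<pi>\<in>?G. smult (matching_weight t V E \<pi>) ([:-1, 1:] ^ ?j \<pi>))"
  have fin: "finite V" using leaf_tree_finite[OF tree] by simp
  \<comment> \<open>The diagonal entry 1 + t (d - 1) is (1 - t) + d t, so the initial weights are Q
    = 1 - t and Y = 1.\<close>
  have "leaf_weights [:t:] (1 - [:t:]) 1"
    by (simp add: leaf_weights_def nonneg_poly_0)
  then have "nonneg_poly (matching_sum ([:t:] * ([:0, 1:] - 1))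
           (\<lambda>v. (1 - [:t:]) + [:t:] * of_nat (card {e \<in> E. v \<in> e}) * 1) (\<lambda>_. 1) V E - (1 - [:t:]))"
    using t by (intro matching_sum_nonneg[OF _ _ tree]) (auto intro!: nonneg_poly_pCons nonneg_poly_0)
  also have "matching_sum ([:t:] * ([:0, 1:] - 1))
           (\<lambda>v. (1 - [:t:]) + [:t:] * of_nat (card {e \<in> E. v \<in> e}) * 1) (\<lambda>_. 1) V E = A"
    unfolding matching_sum_def A_def
  proof (intro sum.cong refl)
    fix \<pi>
    have *: "(1 - [:t:]) + [:t:] * of_nat (card {e \<in> E. v \<in> e}) * 1 = [:?c v:]" for v
      by (simp add: of_nat_poly algebra_simps one_pCons)
    have "(\<Prod>u\<in>V. if \<pi> u = u then [:?c u:] else 1) = (\<Prod>u\<in>V. [:if \<pi> u = u then ?c u else 1:])"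
      by (intro prod.cong) (auto simp: one_pCons)
    also have "\<dots> = [:\<Prod>u\<in>V. if \<pi> u = u then ?c u else 1:]"
      using fin by (induction V rule: finite_induct) (auto simp: one_pCons)
    finally have 1: "(\<Prod>u\<in>V. if \<pi> u = u then [:?c u:] else 1) = [:\<Prod>u\<in>V. if \<pi> u = u then ?c u else 1:]" .
    have "[:t:] * ([:0, 1:] - 1) = smult t [:-1, 1:]" by (simp add: one_pCons)
    then have 2: "([:t:] * ([:0, 1:] - 1)) ^ j = smult (t ^ j) ([:-1, 1:] ^ j)" for j
      by (simp only: smult_power)
    show "([:t:] * ([:0, 1:] - 1)) ^ ?j \<pi> *
        (\<Prod>u\<in>V. if \<pi> u = u then (1 - [:t:]) + [:t:] * of_nat (card {e \<in> E. u \<in> e}) * 1 else 1)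
        = smult (matching_weight t V E \<pi>) ([:-1, 1:] ^ ?j \<pi>)"
      unfolding * 1 2 matching_weight_def by (simp add: mult.commute)
  qed
  finally have A: "nonneg_poly (A - (1 - [:t:]))" .
  show "coeff A i \<ge> 0" if "i \<ge> 1" for i
  proof -
    have "coeff (1 - [:t:]) i = 0" using that by (simp add: coeff_pCons coeff_1 split: nat.split)
    then show ?thesis using A unfolding nonneg_poly_def by (metis coeff_diff diff_zero)
  qed
  fix h :: "nat \<Rightarrow> real"
  \<comment> \<open>The substitution z = 1 + x turns (z - 1)^j into x^j, whose coefficient is paired
    with \<open>h j\<close>. The cutoff suffices because a matching has at most half as many edges
    as there are vertices.\<close>
  define \<Phi> where "\<Phi> p = (\<Sum>l\<le>card V div 2. coeff (pcompose p [:1, 1:]) l * h l)" for p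
  have lin: "\<Phi> (p + q) = \<Phi> p + \<Phi> q" "\<Phi> (smult c p) = c * \<Phi> p" "\<Phi> 0 = 0" for p q c
    by (simp_all add: \<Phi>_def pcompose_add pcompose_smult sum.distrib algebra_simps sum_distrib_left)
  have lin_sum: "\<Phi> (sum f I) = (\<Sum>i\<in>I. \<Phi> (f i))" for f :: "'c \<Rightarrow> real poly" and I
    by (induction I rule: infinite_finite_induct) (auto simp: lin)
  have pw: "pcompose (p ^ j) q = pcompose p q ^ j" for p q :: "real poly" and j
    by (induction j) (auto simp: pcompose_mult pcompose_1)
  have jle: "?j \<pi> \<le> card V div 2" for \<pi> using fin by (intro div_le_mono card_mono) auto
  have "\<Phi> ([:-1, 1:] ^ j) = h j" if "j \<le> card V div 2" for j
  proof -
    have "pcompose ([:-1, 1:] ^ j) [:1, 1:] = (monom 1 j :: real poly)"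
      by (simp add: pw pcompose_pCons monom_altdef one_pCons)
    then show ?thesis using that by (simp add: \<Phi>_def if_distrib[of "\<lambda>c. c * _"] cong: if_cong)
  qed
  then have 1: "\<Phi> A = (\<Sum>\<pi>\<in>?G. h (?j \<pi>) * matching_weight t V E \<pi>)"
    unfolding A_def lin_sum by (intro sum.cong refl) (simp add: lin jle)
  have dA: "degree A \<le> card V div 2"
    unfolding A_def
    by (rule degree_sum_le[OF finite_graph_perms[OF fin]], rule order.trans[OF degree_smult_le],
        rule order.trans[OF degree_power_le]) (use jle in simp)
  have "A = (\<Sum>i\<le>card V div 2. smult (coeff A i) ([:0, 1:] ^ i))"
    by (subst poly_as_sum_of_monoms'[OF dA, symmetric]) (simp add: monom_altdef)
  then have "\<Phi> A = (\<Sum>i\<le>card V div 2. coeff A i * \<Phi> ([:0, 1:] ^ i))"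
    by (metis (no_types, lifting) lin_sum lin(2) sum.cong)
  also have "\<dots> = (\<Sum>i\<le>card V div 2. coeff A i * (\<Sum>j\<le>i. real (i choose j) * h j))"
  proof (intro sum.cong refl arg_cong2[where f = "(*)"])
    fix i assume i: "i \<in> {..card V div 2}"
    have c: "coeff ([:1, 1:] ^ i) l = real (i choose l)" for l
      by (cases "l \<le> i") (auto simp: coeff_linear_poly_power binomial_eq_0 coeff_eq_0 degree_linear_power)
    have "pcompose ([:0, 1:] ^ i) [:1, 1:] = ([:1, 1:] ^ i :: real poly)"
      by (simp add: pw pcompose_pCons)
    then have "\<Phi> ([:0, 1:] ^ i) = (\<Sum>l\<le>card V div 2. real (i choose l) * h l)"
      by (simp add: \<Phi>_def c)
    also have "\<dots> = (\<Sum>l\<le>i. real (i choose l) * h l)"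
      using i by (intro sum.mono_neutral_right) (auto simp: binomial_eq_0)
    finally show "\<Phi> ([:0, 1:] ^ i) = (\<Sum>j\<le>i. real (i choose j) * h j)" .
  qed
  finally show "(\<Sum>\<pi>\<in>?G. h (?j \<pi>) * matching_weight t V E \<pi>)
      = (\<Sum>i\<le>card V div 2. coeff A i * (\<Sum>j\<le>i. real (i choose j) * h j))"
    using 1 by simp
qed

section \<open>Two-row characters\<close>

abbreviation fun_linear :: "(('x \<Rightarrow> complex) \<Rightarrow> 'y \<Rightarrow> complex) \<Rightarrow> bool" where
  "fun_linear \<equiv> module_hom fun_scale fun_scale"

lemma fun_linear_iff:
  "fun_linear F \<longleftrightarrow> (\<forall>f g. F (f + g) = F f + F g) \<and> (\<forall>c f. F (fun_scale c f) = fun_scale c (F f))"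
  by (simp add: module_hom_iff fun_vs.module_axioms)

lemma sum_fun_apply: "sum f I x = (\<Sum>i\<in>I. f i x)"
  by (induction I rule: infinite_finite_induct) auto

definition point_fun :: "'x \<Rightarrow> 'x \<Rightarrow> complex" where
  "point_fun x = (\<lambda>y. if y = x then 1 else 0)"

lemma finite_support_expansion:
  assumes "finite X" "\<And>x. x \<notin> X \<Longrightarrow> f x = 0"
  shows "f = (\<Sum>x\<in>X. fun_scale (f x) (point_fun x))"
proof
  fix y
  show "f y = (\<Sum>x\<in>X. fun_scale (f x) (point_fun x)) y"
    using assms by (auto simp: sum_fun_apply fun_scale_def point_fun_def if_distrib sum.delta cong: if_cong)
qed

text \<open>The trace on a subspace is the trace of the composition with any projection onto it; the
  projection need not commute with the endomorphism.\<close>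

lemma trace_on_projection:
  assumes X: "finite X" "\<And>v x. v \<in> V \<Longrightarrow> x \<notin> X \<Longrightarrow> v x = 0" and V: "fun_vs.subspace V"
    and P: "fun_linear P" "\<And>h. P h \<in> V" "\<And>v. v \<in> V \<Longrightarrow> P v = v"
    and F: "fun_linear F" "\<And>v. v \<in> V \<Longrightarrow> F v \<in> V"
  shows "trace_on V F = (\<Sum>x\<in>X. F (P (point_fun x)) x)"
proof -
  define B where "B = (SOME B. fun_vs.independent B \<and> fun_vs.span B = V)"
  have "\<exists>B. fun_vs.independent B \<and> fun_vs.span B = V"
    using fun_vs.basis_exists[of V] V by (metis fun_vs.span_minimal subset_antisym)
  then have "fun_vs.independent B \<and> fun_vs.span B = V"
    unfolding B_def by (rule someI_ex)
  then have ind: "fun_vs.independent B" and span: "fun_vs.span B = V" by auto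
  have expand: "v = (\<Sum>x\<in>X. fun_scale (v x) (point_fun x))" if "v \<in> V" for v
    using X that by (intro finite_support_expansion) auto
  have "B \<subseteq> fun_vs.span (point_fun ` X)"
  proof
    fix b assume "b \<in> B"
    then have "b \<in> V" using span fun_vs.span_base by blast
    moreover have "(\<Sum>x\<in>X. fun_scale (b x) (point_fun x)) \<in> fun_vs.span (point_fun ` X)"
      by (intro fun_vs.span_sum fun_vs.span_scale fun_vs.span_base imageI)
    ultimately show "b \<in> fun_vs.span (point_fun ` X)" using expand[of b] by simp
  qed
  then have fin: "finite B" using fun_vs.independent_span_bound[OF _ ind] X(1) by blast
  let ?r = "fun_vs.representation B"
  have "?r (F b) c = (\<Sum>x\<in>X. F b x * ?r (P (point_fun x)) c)" if "b \<in> B" for b c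
  proof -
    have FbV: "F b \<in> V" using that F(2) span fun_vs.span_base by blast
    \<comment> \<open>Inserting P, which fixes \<open>F b\<close>, replaces point functions outside
      V by elements of V, so that coordinates in B can be taken term by term.\<close>
    have "F b = P (\<Sum>x\<in>X. fun_scale (F b x) (point_fun x))"
      using expand[OF FbV] P(3)[OF FbV] by simp
    also have "\<dots> = (\<Sum>x\<in>X. fun_scale (F b x) (P (point_fun x)))"
      by (simp add: module_hom.sum[OF P(1)] module_hom.scale[OF P(1)])
    finally have "?r (F b) = ?r (\<Sum>x\<in>X. fun_scale (F b x) (P (point_fun x)))" by simp
    also have "\<dots> = (\<lambda>c. \<Sum>x\<in>X. F b x * ?r (P (point_fun x)) c)"
      using P(2) span
      by (subst fun_vs.representation_sum[OF ind])
         (auto simp: fun_vs.representation_scale[OF ind] intro!: fun_vs.span_scale)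
    finally show ?thesis by simp
  qed
  then have "trace_on V F = (\<Sum>b\<in>B. \<Sum>x\<in>X. F b x * ?r (P (point_fun x)) b)"
    unfolding trace_on_def Let_def B_def[symmetric] by simp
  also have "\<dots> = (\<Sum>x\<in>X. \<Sum>b\<in>B. ?r (P (point_fun x)) b * F b x)"
    by (subst sum.swap) (simp add: mult.commute)
  also have "\<dots> = (\<Sum>x\<in>X. F (\<Sum>b\<in>B. fun_scale (?r (P (point_fun x)) b) b) x)"
    by (simp only: module_hom.sum[OF F(1)] module_hom.scale[OF F(1)] sum_fun_apply)
       (simp only: fun_scale_def)
  also have "\<dots> = (\<Sum>x\<in>X. F (P (point_fun x)) x)"
    using P(2) span fin by (subst fun_vs.sum_representation_eq[OF ind]) auto
  finally show ?thesis .
qed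

section \<open>Raising and lowering maps on the Boolean lattice\<close>

definition subset_funs :: "'v set \<Rightarrow> nat \<Rightarrow> ('v set \<Rightarrow> complex) set" where
  "subset_funs N k = {f. \<forall>B. f B \<noteq> 0 \<longrightarrow> B \<subseteq> N \<and> card B = k}"

definition down :: "'v set \<Rightarrow> ('v set \<Rightarrow> complex) \<Rightarrow> 'v set \<Rightarrow> complex" where
  "down N f = (\<lambda>C. \<Sum>y\<in>N - C. f (insert y C))"

definition up :: "'v set \<Rightarrow> ('v set \<Rightarrow> complex) \<Rightarrow> 'v set \<Rightarrow> complex" where
  "up N f = (\<lambda>B. \<Sum>y\<in>B \<inter> N. f (B - {y}))"

lemma subspace_subset_funs: "fun_vs.subspace (subset_funs N k)"
  unfolding fun_vs.subspace_def subset_funs_def by (auto simp: fun_scale_def) force+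

lemma fun_linear_down: "fun_linear (down N)"
  by (auto simp: fun_linear_iff down_def fun_scale_def fun_eq_iff sum.distrib sum_distrib_left)

lemma fun_linear_up: "fun_linear (up N)"
  by (auto simp: fun_linear_iff up_def fun_scale_def fun_eq_iff sum.distrib sum_distrib_left)

lemmas down_simps = module_hom.add[OF fun_linear_down] module_hom.diff[OF fun_linear_down]
  module_hom.scale[OF fun_linear_down] module_hom.zero[OF fun_linear_down]

lemmas up_simps = module_hom.add[OF fun_linear_up] module_hom.diff[OF fun_linear_up]
  module_hom.scale[OF fun_linear_up] module_hom.zero[OF fun_linear_up]

lemma down_in_subset_funs:
  assumes "finite N" "f \<in> subset_funs N (Suc k)"
  shows "down N f \<in> subset_funs N k"
  unfolding subset_funs_def
proof (intro CollectI allI impI)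
  fix C assume "down N f C \<noteq> 0"
  then obtain y where y: "y \<in> N - C" "f (insert y C) \<noteq> 0"
    by (auto simp: down_def dest: sum.not_neutral_contains_not_neutral)
  then have C: "insert y C \<subseteq> N" "card (insert y C) = Suc k"
    using assms(2) by (auto simp: subset_funs_def)
  have "finite C" using finite_subset[OF C(1) assms(1)] by simp
  then show "C \<subseteq> N \<and> card C = k" using y(1) C by simp
qed

lemma up_in_subset_funs:
  assumes "finite N" "f \<in> subset_funs N k"
  shows "up N f \<in> subset_funs N (Suc k)"
  unfolding subset_funs_def
proof (intro CollectI allI impI)
  fix B assume "up N f B \<noteq> 0"
  then obtain y where y: "y \<in> B \<inter> N" "f (B - {y}) \<noteq> 0"
    by (auto simp: up_def dest: sum.not_neutral_contains_not_neutral)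
  then have C: "B - {y} \<subseteq> N" "card (B - {y}) = k"
    using assms(2) by (auto simp: subset_funs_def)
  have "finite B" using finite_subset[OF C(1) assms(1)] by simp
  then have "card B = Suc k" using C(2) y(1) card.remove[of B y] by simp
  then show "B \<subseteq> N \<and> card B = Suc k" using C y by auto
qed

lemma down_subset_funs_0:
  assumes "finite N" "f \<in> subset_funs N 0"
  shows "down N f = 0"
proof
  fix C
  have "f (insert y C) = 0" for y
  proof (rule ccontr)
    assume "f (insert y C) \<noteq> 0"
    then have "insert y C \<subseteq> N" "card (insert y C) = 0" using assms(2) by (auto simp: subset_funs_def)
    then show False using finite_subset[OF _ assms(1), of "insert y C"] by (simp add: card_eq_0_iff)
  qed
  then show "down N f C = 0 C" by (simp add: down_def)
qed

text \<open>The sl_2 relation. Exchanging one element of C for another contributes equally in both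
  orders. What differs is returning to C: n - k ways by adding first and k ways by removing
  first.\<close>

lemma down_up_commute:
  assumes N: "finite N" and f: "f \<in> subset_funs N k"
  shows "down N (up N f) = up N (down N f) + fun_scale (of_nat (card N) - 2 * of_nat k) f"
proof
  fix C
  show "down N (up N f) C = (up N (down N f) + fun_scale (of_nat (card N) - 2 * of_nat k) f) C"
  proof (cases "C \<subseteq> N")
    case False
    have z: "f (insert y C - {z}) = 0" "f (insert y (C - {z})) = 0" if "z \<in> N" for y z
      using False that f unfolding subset_funs_def by blast+
    have "down N (up N f) C = 0" "up N (down N f) C = 0"
      unfolding down_def up_def using z by (intro sum.neutral ballI; blast)+
    moreover have "f C = 0" using False f unfolding subset_funs_def by blast
    ultimately show ?thesis by (simp add: fun_scale_def)
  next
    case True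
    have fin: "finite C" "finite (N - C)" using True N finite_subset by auto
    let ?S = "\<Sum>y\<in>N - C. \<Sum>z\<in>C. f (insert y (C - {z}))"
    have "down N (up N f) C = (\<Sum>y\<in>N - C. f C + (\<Sum>z\<in>C. f (insert y (C - {z}))))"
      unfolding down_def up_def
    proof (intro sum.cong refl)
      fix y assume y: "y \<in> N - C"
      have "insert y C \<inter> N = insert y C" "y \<notin> C" using y True by auto
      moreover have "(\<Sum>z\<in>C. f (insert y C - {z})) = (\<Sum>z\<in>C. f (insert y (C - {z})))"
        using y by (intro sum.cong refl arg_cong[where f = f]) auto
      ultimately show "(\<Sum>z\<in>insert y C \<inter> N. f (insert y C - {z})) = f C + (\<Sum>z\<in>C. f (insert y (C - {z})))"
        using fin by simp
    qed
    also have "\<dots> = of_nat (card (N - C)) * f C + ?S" by (simp add: sum.distrib)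
    finally have 1: "down N (up N f) C = of_nat (card (N - C)) * f C + ?S" .
    have "up N (down N f) C = (\<Sum>z\<in>C. f C + (\<Sum>y\<in>N - C. f (insert y (C - {z}))))"
      unfolding down_def up_def
    proof (rule sum.cong)
      show "C \<inter> N = C" using True by auto
      fix z assume z: "z \<in> C"
      then have "N - (C - {z}) = insert z (N - C)" "z \<notin> N - C" "insert z (C - {z}) = C" using True by auto
      then show "(\<Sum>y\<in>N - (C - {z}). f (insert y (C - {z}))) = f C + (\<Sum>y\<in>N - C. f (insert y (C - {z})))"
        using fin by simp
    qed
    also have "\<dots> = of_nat (card C) * f C + ?S"
      by (simp add: sum.distrib) (rule sum.swap)
    finally have 2: "up N (down N f) C = of_nat (card C) * f C + ?S" .
    have "card N = card (N - C) + card C"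
      using card_Diff_subset[OF fin(1) True] card_mono[OF N True] by simp
    moreover have "f C = 0 \<or> card C = k" using f unfolding subset_funs_def by blast
    ultimately show ?thesis unfolding plus_fun_def 1 2
      by (auto simp: fun_scale_def algebra_simps)
  qed
qed

text \<open>The resolvent is obtained by the Woodbury formula
  \<open>(up down + c)\<^sup>-\<^sup>1 = (1 - up (down up + c)\<^sup>-\<^sup>1 down) / c\<close> and the commutation relation.\<close>

lemma up_down_resolvent:
  fixes c :: real
  assumes N: "finite N" and "c > 0" "2 * k \<le> card N + 2"
  shows "\<exists>R. fun_linear R \<and> (\<forall>f\<in>subset_funs N k. R f \<in> subset_funs N k \<and>
           up N (down N (R f)) + fun_scale (of_real c) (R f) = f)"
  using assms(2,3)
proof (induction k arbitrary: c)
  case 0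
  have "up N (down N (fun_scale (1 / of_real c) f)) + fun_scale (of_real c) (fun_scale (1 / of_real c) f) = f"
    if "f \<in> subset_funs N 0" for f
    using 0 that by (simp add: down_simps down_subset_funs_0[OF N] up_simps)
  then show ?case
    using fun_vs.subspace_scale[OF subspace_subset_funs[of N 0]]
    by (intro exI[of _ "fun_scale (1 / of_real c)"])
       (auto simp: fun_linear_iff fun_vs.scale_right_distrib mult.commute)
next
  case (Suc k)
  \<comment> \<open>On level k the commutation relation turns down up + c into up down + c'. The
    bound \<open>2 * Suc k \<le> card N + 2\<close> keeps c' at least c, hence positive.\<close>
  define c' where "c' = c + (real (card N) - 2 * real k)"
  have c': "c' > 0" "2 * k \<le> card N + 2" using Suc.prems by (simp_all add: c'_def)
  obtain R where R: "fun_linear R"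
    and Rk: "\<And>f. f \<in> subset_funs N k \<Longrightarrow> R f \<in> subset_funs N k"
    and Req: "\<And>f. f \<in> subset_funs N k \<Longrightarrow> up N (down N (R f)) + fun_scale (of_real c') (R f) = f"
    using Suc.IH[OF c'] by blast
  define R' where "R' f = fun_scale (1 / of_real c) (f - up N (R (down N f)))" for f
  have "fun_linear R'"
    unfolding fun_linear_iff R'_def down_simps up_simps module_hom.add[OF R] module_hom.scale[OF R]
    by (auto simp: fun_scale_def fun_eq_iff algebra_simps)
  moreover have "R' f \<in> subset_funs N (Suc k) \<and> up N (down N (R' f)) + fun_scale (of_real c) (R' f) = f"
    if f: "f \<in> subset_funs N (Suc k)" for f
  proof
    let ?g = "down N f"
    let ?r = "R ?g"
    have g: "?g \<in> subset_funs N k" using down_in_subset_funs[OF N f] .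
    have r: "?r \<in> subset_funs N k" using Rk[OF g] .
    show "R' f \<in> subset_funs N (Suc k)"
      unfolding R'_def using subspace_subset_funs f up_in_subset_funs[OF N r]
      by (intro fun_vs.subspace_scale fun_vs.subspace_diff) auto
    have "down N (up N ?r) = ?g - fun_scale (of_real c) ?r"
    proof
      fix C
      have "up N (down N ?r) C + of_real c' * ?r C = ?g C"
        using fun_cong[OF Req[OF g], of C] by (simp add: fun_scale_def)
      then show "down N (up N ?r) C = (?g - fun_scale (of_real c) ?r) C"
        unfolding down_up_commute[OF N r] by (simp add: fun_scale_def c'_def algebra_simps)
    qed
    then have dR: "down N (R' f) = ?r"
      unfolding R'_def down_simps using Suc.prems(1) by (simp add: fun_scale_def fun_eq_iff)
    show "up N (down N (R' f)) + fun_scale (of_real c) (R' f) = f"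
      unfolding dR using Suc.prems(1) by (simp add: R'_def fun_scale_def fun_eq_iff)
  qed
  ultimately show ?case by blast
qed

text \<open>With c = n - 2k > 0, down up equals up down + c on level k. Composing up with the
  resolvent of the latter inverts down from the right.\<close>

lemma down_right_inverse:
  assumes N: "finite N" and k: "2 * k < card N"
  obtains S where "fun_linear S" "\<And>f. f \<in> subset_funs N k \<Longrightarrow> S f \<in> subset_funs N (Suc k)"
    "\<And>f. f \<in> subset_funs N k \<Longrightarrow> down N (S f) = f"
proof -
  define c where "c = real (card N) - 2 * real k"
  have c: "c > 0" "2 * k \<le> card N + 2" using k by (simp_all add: c_def)
  obtain R where R: "fun_linear R"
    and Rk: "\<And>f. f \<in> subset_funs N k \<Longrightarrow> R f \<in> subset_funs N k"
    and Req: "\<And>f. f \<in> subset_funs N k \<Longrightarrow> up N (down N (R f)) + fun_scale (of_real c) (R f) = f"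
    using up_down_resolvent[OF N c] by blast
  show ?thesis
  proof
    show "fun_linear (up N \<circ> R)" using R fun_linear_up by (rule module_hom_compose)
    fix f :: "'a set \<Rightarrow> complex" assume f: "f \<in> subset_funs N k"
    show "(up N \<circ> R) f \<in> subset_funs N (Suc k)" using up_in_subset_funs[OF N Rk[OF f]] by simp
    show "down N ((up N \<circ> R) f) = f"
      using Req[OF f] down_up_commute[OF N Rk[OF f]] by (simp add: c_def)
  qed
qed

text \<open>Raising f preserves the hypothesis and makes the eigenvalue more negative, while levels
  above n are zero. So up f = 0 by induction, and then a f = 0.\<close>

lemma down_up_negative_eigenvalue:
  fixes a :: real
  assumes N: "finite N" and "f \<in> subset_funs N k" "2 * k > card N"
    and "down N (up N f) = fun_scale (of_real a) f" "a < 0"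
  shows "f = 0"
  using assms(2-)
proof (induction "card N + 1 - k" arbitrary: k f a rule: less_induct)
  case less
  show ?case
  proof (cases "k > card N")
    case True
    have "f B = 0" for B
      using less.prems(1) True card_mono[OF N, of B] unfolding subset_funs_def by fastforce
    then show ?thesis by auto
  next
    case False
    let ?g = "up N f" and ?b = "a + (real (card N) - 2 * real (Suc k))"
    have g: "?g \<in> subset_funs N (Suc k)" using up_in_subset_funs[OF N less.prems(1)] .
    have e: "down N (up N ?g) = fun_scale (of_real ?b) ?g"
      unfolding down_up_commute[OF N g] less.prems(3) up_simps
      by (simp add: fun_scale_def fun_eq_iff algebra_simps)
    have b: "?b < 0" using less.prems by simp
    have "?g = 0" using False less.prems(2) by (intro less.hyps[OF _ g _ e b]) auto
    then have "fun_scale (of_real a) f = 0" using less.prems(3) by (simp add: down_simps)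
    then show ?thesis using less.prems(4) by (auto simp: fun_scale_def fun_eq_iff)
  qed
qed

text \<open>On the kernel of down, down up is multiplication by n - 2k, which is negative above the
  middle level.\<close>

lemma down_kernel_trivial:
  assumes N: "finite N" and f: "f \<in> subset_funs N k" and k: "2 * k > card N" and "down N f = 0"
  shows "f = 0"
  using down_up_commute[OF N f] assms
  by (intro down_up_negative_eigenvalue[OF N f k, of "real (card N) - 2 * real k"]) (auto simp: up_simps)

section \<open>Products of differences x_b - x_a over disjoint pairs, evaluated at indicator
  vectors\<close>

definition pair_prod :: "('v \<times> 'v) list \<Rightarrow> 'v set \<Rightarrow> complex" where
  "pair_prod ps B = (\<Prod>(a, b)\<leftarrow>ps. of_bool (b \<in> B) - of_bool (a \<in> B))"

definition pair_set :: "('v \<times> 'v) list \<Rightarrow> 'v set" where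
  "pair_set ps = fst ` set ps \<union> snd ` set ps"

definition disjoint_pairs :: "('v \<times> 'v) list \<Rightarrow> bool" where
  "disjoint_pairs ps \<longleftrightarrow> distinct (map fst ps @ map snd ps)"

definition pair_fun :: "('v \<times> 'v) list \<Rightarrow> 'v set \<Rightarrow> complex" where
  "pair_fun ps B = (if B \<subseteq> pair_set ps \<and> card B = length ps then pair_prod ps B else 0)"

definition pair_funs :: "'v set \<Rightarrow> nat \<Rightarrow> ('v set \<Rightarrow> complex) set" where
  "pair_funs N k = {pair_fun ps | ps. disjoint_pairs ps \<and> pair_set ps \<subseteq> N \<and> length ps = k}"

lemma disjoint_pairs_Cons:
  "disjoint_pairs ((a, b) # ps) \<longleftrightarrow> a \<noteq> b \<and> a \<notin> pair_set ps \<and> b \<notin> pair_set ps \<and> disjoint_pairs ps"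
  by (auto simp: disjoint_pairs_def pair_set_def)

lemma pair_set_Cons: "pair_set ((a, b) # ps) = insert a (insert b (pair_set ps))"
  by (auto simp: pair_set_def)

lemma disjoint_pairs_append:
  "disjoint_pairs (ps @ qs) \<longleftrightarrow> disjoint_pairs ps \<and> disjoint_pairs qs \<and> pair_set ps \<inter> pair_set qs = {}"
  by (auto simp: disjoint_pairs_def pair_set_def)

lemma pair_set_memI: "(a, b) \<in> set ps \<Longrightarrow> a \<in> pair_set ps \<and> b \<in> pair_set ps"
  by (force simp: pair_set_def)

lemma finite_pair_set: "finite (pair_set ps)"
  by (simp add: pair_set_def)

lemma card_pair_set: "disjoint_pairs ps \<Longrightarrow> card (pair_set ps) = 2 * length ps"
  using distinct_card[of "map fst ps @ map snd ps"] by (simp add: disjoint_pairs_def pair_set_def)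

lemma pair_prod_Cons: "pair_prod ((a, b) # ps) B = (of_bool (b \<in> B) - of_bool (a \<in> B)) * pair_prod ps B"
  by (simp add: pair_prod_def)

lemma pair_prod_append: "pair_prod (ps @ qs) B = pair_prod ps B * pair_prod qs B"
  by (simp add: pair_prod_def)

lemma pair_prod_cong:
  assumes "B \<inter> pair_set ps = B' \<inter> pair_set ps"
  shows "pair_prod ps B = pair_prod ps B'"
proof -
  have "x \<in> B \<longleftrightarrow> x \<in> B'" if "x \<in> pair_set ps" for x using assms that by blast
  then show ?thesis unfolding pair_prod_def
    by (intro arg_cong[where f = prod_list] map_cong refl) (auto simp: pair_set_memI)
qed

lemma length_le_card_transversal:
  assumes "disjoint_pairs ps" "finite C" "\<And>a b. (a, b) \<in> set ps \<Longrightarrow> a \<in> C \<or> b \<in> C"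
  shows "length ps \<le> card C"
  using assms
proof (induction ps arbitrary: C)
  case (Cons p ps)
  obtain a b where p: "p = (a, b)" by fastforce
  have "length ps \<le> card (C - {a, b})"
  proof (rule Cons.IH)
    show "disjoint_pairs ps" "finite (C - {a, b})" using Cons.prems p by (auto simp: disjoint_pairs_Cons)
    fix c d assume cd: "(c, d) \<in> set ps"
    then have "c \<in> pair_set ps" "d \<in> pair_set ps" by (auto simp: pair_set_memI)
    then have "c \<notin> {a, b}" "d \<notin> {a, b}" using Cons.prems(1) p by (auto simp: disjoint_pairs_Cons)
    moreover have "c \<in> C \<or> d \<in> C" using Cons.prems(3) cd by auto
    ultimately show "c \<in> C - {a, b} \<or> d \<in> C - {a, b}" by auto
  qed
  moreover have "card (C - {a, b}) < card C"
    using Cons.prems(2,3) p by (intro psubset_card_mono) auto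
  ultimately show ?case by simp
qed simp

lemma pair_fun_in_subset_funs:
  "pair_set ps \<subseteq> N \<Longrightarrow> pair_fun ps \<in> subset_funs N (length ps)"
  by (auto simp: subset_funs_def pair_fun_def split: if_splits)

text \<open>If C misses both ends of a pair, the factor of that pair kills all extensions of C
  except those by a and by b, and these two have opposite signs. If C meets every pair, it has at
  least as many elements as there are pairs, so every extension is too large.\<close>

lemma down_pair_fun:
  assumes dis: "disjoint_pairs ps" and N: "finite N" "pair_set ps \<subseteq> N"
  shows "down N (pair_fun ps) = 0"
proof
  fix C
  have "down N (pair_fun ps) C = 0"
  proof (cases "C \<subseteq> pair_set ps \<and> (\<exists>a b. (a, b) \<in> set ps \<and> a \<notin> C \<and> b \<notin> C)")
    case False
    have "pair_fun ps (insert y C) = 0" if "y \<in> N - C" for y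
    proof (cases "C \<subseteq> pair_set ps")
      case True
      then have fin: "finite C" using finite_pair_set finite_subset by blast
      have "length ps \<le> card C" using True False by (intro length_le_card_transversal[OF dis fin]) auto
      then show ?thesis using that fin by (simp add: pair_fun_def)
    qed (auto simp: pair_fun_def)
    then show ?thesis unfolding down_def by (intro sum.neutral) auto
  next
    case True
    then obtain a b where ab: "(a, b) \<in> set ps" "a \<notin> C" "b \<notin> C" and C: "C \<subseteq> pair_set ps" by blast
    then have fin: "finite C" using finite_pair_set finite_subset by blast
    obtain p1 p2 where ps: "ps = p1 @ (a, b) # p2" using ab(1) by (meson split_list)
    have d: "a \<noteq> b" "a \<notin> pair_set p1" "b \<notin> pair_set p1" "a \<notin> pair_set p2" "b \<notin> pair_set p2"
      using dis by (auto simp: ps disjoint_pairs_append disjoint_pairs_Cons pair_set_Cons)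
    have m: "a \<in> pair_set ps" "b \<in> pair_set ps" using pair_set_memI[OF ab(1)] by auto
    have rest: "pair_prod p (insert a C) = pair_prod p (insert b C)" if "a \<notin> pair_set p" "b \<notin> pair_set p" for p
      using that by (intro pair_prod_cong) auto
    have "pair_prod ps (insert a C) = - pair_prod ps (insert b C)"
      using ab d rest[of p1] rest[of p2] by (simp add: ps pair_prod_append pair_prod_Cons)
    then have neg: "pair_fun ps (insert a C) = - pair_fun ps (insert b C)"
      using m C fin ab by (simp add: pair_fun_def)
    have zero: "pair_fun ps (insert y C) = 0" if "y \<noteq> a" "y \<noteq> b" for y
      using that ab by (simp add: pair_fun_def ps pair_prod_append pair_prod_Cons)
    have "down N (pair_fun ps) C = (\<Sum>y\<in>{a, b}. pair_fun ps (insert y C))"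
      unfolding down_def using N m ab zero by (intro sum.mono_neutral_right) auto
    then show ?thesis using neg d by simp
  qed
  then show "down N (pair_fun ps) C = 0 C" by simp
qed

definition down_kernel :: "'v set \<Rightarrow> nat \<Rightarrow> ('v set \<Rightarrow> complex) set" where
  "down_kernel N k = {f \<in> subset_funs N k. down N f = 0}"

lemma subspace_down_kernel: "fun_vs.subspace (down_kernel N k)"
  using subspace_subset_funs[of N k] unfolding fun_vs.subspace_def down_kernel_def
  by (simp del: plus_fun_apply zero_fun_apply add: down_simps)

lemma span_pair_funs_subset:
  assumes "finite N"
  shows "fun_vs.span (pair_funs N k) \<subseteq> down_kernel N k"
proof (rule fun_vs.span_minimal[OF _ subspace_down_kernel])
  show "pair_funs N k \<subseteq> down_kernel N k"
    using assms by (auto simp: pair_funs_def down_kernel_def pair_fun_in_subset_funs down_pair_fun)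
qed

lemma pair_funs_mono: "N \<subseteq> N' \<Longrightarrow> pair_funs N k \<subseteq> pair_funs N' k"
  by (auto simp: pair_funs_def)

text \<open>Each generator gets the extra pair (y, x), where y is a point of N that it leaves free;
  2k < card N provides one. On a set containing x and y the new factor vanishes, and so does the old
  generator because y lies outside its pairs.\<close>

lemma span_pair_funs_lift:
  assumes "g \<in> fun_vs.span (pair_funs N k)" and N: "finite N" "2 * k < card N" and x: "x \<notin> N"
  shows "\<exists>h\<in>fun_vs.span (pair_funs (insert x N) (Suc k)). \<forall>B\<subseteq>N. h (insert x B) = g B"
  using assms(1)
proof (induction rule: fun_vs.span_induct_alt)
  case base
  show ?case using fun_vs.span_zero by (intro bexI[of _ 0]) auto
next
  case (step c e g)
  then obtain h where h: "h \<in> fun_vs.span (pair_funs (insert x N) (Suc k))" "\<And>B. B \<subseteq> N \<Longrightarrow> h (insert x B) = g B"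
    by blast
  from step(1) obtain ps where ps: "e = pair_fun ps" "disjoint_pairs ps" "pair_set ps \<subseteq> N" "length ps = k"
    by (auto simp: pair_funs_def)
  have "card (pair_set ps) < card N" using card_pair_set[OF ps(2)] ps(4) N(2) by simp
  then obtain y where y: "y \<in> N" "y \<notin> pair_set ps" using ps(3) by (metis less_irrefl subset_antisym subsetI)
  let ?qs = "(y, x) # ps"
  have xps: "x \<notin> pair_set ps" "x \<noteq> y" using x y ps(3) by auto
  have "pair_fun ?qs \<in> pair_funs (insert x N) (Suc k)"
    using y xps ps by (auto simp: pair_funs_def disjoint_pairs_Cons pair_set_Cons intro!: exI[of _ ?qs])
  then have "fun_scale c (pair_fun ?qs) + h \<in> fun_vs.span (pair_funs (insert x N) (Suc k))"
    by (intro fun_vs.span_add[OF fun_vs.span_scale[OF fun_vs.span_base] h(1)])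
  moreover have "(fun_scale c (pair_fun ?qs) + h) (insert x B) = (fun_scale c e + g) B" if B: "B \<subseteq> N" for B
  proof -
    have "finite B" "x \<notin> B" using B N(1) x finite_subset by auto
    moreover have "pair_prod ps (insert x B) = pair_prod ps B" using xps by (intro pair_prod_cong) auto
    moreover have "insert x B \<subseteq> pair_set ?qs \<longleftrightarrow> B \<subseteq> pair_set ps" if "y \<notin> B"
      using that \<open>x \<notin> B\<close> by (auto simp: pair_set_Cons)
    ultimately have "pair_fun ?qs (insert x B) = e B"
      using y xps ps(4) unfolding ps(1) by (cases "y \<in> B") (auto simp: pair_fun_def pair_prod_Cons)
    then show ?thesis using h(2)[OF B] by (simp add: fun_scale_def)
  qed
  ultimately show ?case by blast
qed

text \<open>Branching on a point x. The link g(B) = f(B with x added) is a kernel element one level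
  lower, hence a combination of pair functions on N. Lifting it gives h in the span with f - h
  vanishing on all sets that contain x, so f - h lives on N, where the induction applies
  again.\<close>

lemma down_kernel_eq_span:
  assumes "finite N" "2 * k \<le> card N"
  shows "down_kernel N k = fun_vs.span (pair_funs N k)"
proof
  show "fun_vs.span (pair_funs N k) \<subseteq> down_kernel N k" using assms(1) by (rule span_pair_funs_subset)
  show "down_kernel N k \<subseteq> fun_vs.span (pair_funs N k)"
    using assms
  proof (induction N arbitrary: k rule: finite_induct)
    case empty
    show ?case
    proof
      fix f assume "f \<in> down_kernel {} k"
      then have "f B = 0" if "B \<noteq> {}" for B using that by (auto simp: down_kernel_def subset_funs_def)
      then have "f = fun_scale (f {}) (pair_fun [])"
        by (auto simp: fun_scale_def pair_fun_def pair_set_def pair_prod_def fun_eq_iff)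
      moreover have "pair_fun [] \<in> pair_funs {} k"
        using empty by (auto simp: pair_funs_def disjoint_pairs_def pair_set_def)
      ultimately show "f \<in> fun_vs.span (pair_funs {} k)"
        by (metis fun_vs.span_base fun_vs.span_scale)
    qed
  next
    case (insert x N)
    show ?case
    proof
      fix f assume "f \<in> down_kernel (insert x N) k"
      then have f: "f \<in> subset_funs (insert x N) k" "down (insert x N) f = 0"
        by (auto simp: down_kernel_def)
      let ?S = "fun_vs.span (pair_funs (insert x N) k)"
      have smaller: "g \<in> ?S" if g: "g \<in> down_kernel (insert x N) k" "\<And>B. x \<in> B \<Longrightarrow> g B = 0" for g
      proof -
        have gN: "g \<in> subset_funs N k"
          unfolding subset_funs_def
        proof (intro CollectI allI impI)
          fix B assume B: "g B \<noteq> 0"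
          then have "x \<notin> B" using g(2) by blast
          moreover have "B \<subseteq> insert x N" "card B = k" using B g(1) by (auto simp: down_kernel_def subset_funs_def)
          ultimately show "B \<subseteq> N \<and> card B = k" by blast
        qed
        have "down N g = 0"
        proof
          fix C
          have "down N g C = down (insert x N) g C"
            unfolding down_def using insert.hyps(1) g(2) by (intro sum.mono_neutral_left) auto
          also have "\<dots> = 0" using g(1) by (simp add: down_kernel_def)
          finally show "down N g C = 0 C" by simp
        qed
        with gN have gK: "g \<in> down_kernel N k" by (simp add: down_kernel_def)
        show ?thesis
        proof (cases "2 * k \<le> card N")
          case True
          then have "g \<in> fun_vs.span (pair_funs N k)" using insert.IH gK by blast
          moreover have "fun_vs.span (pair_funs N k) \<subseteq> ?S"
            by (intro fun_vs.span_mono pair_funs_mono) auto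
          ultimately show ?thesis by blast
        next
          case False
          \<comment> \<open>Only 2k = card N + 1 remains, and above the middle of N the lowering map
            is injective.\<close>
          then have "g = 0" using gK down_kernel_trivial[OF insert.hyps(1), of g k] by (simp add: down_kernel_def)
          then show ?thesis using fun_vs.span_zero by simp
        qed
      qed
      show "f \<in> ?S"
      proof (cases k)
        case 0
        have "f B = 0" if "x \<in> B" for B
        proof (rule ccontr)
          assume "f B \<noteq> 0"
          then have "B \<subseteq> insert x N" "card B = 0" using f(1) 0 by (auto simp: subset_funs_def)
          then show False using that insert.hyps(1) finite_subset[of B "insert x N"] by auto
        qed
        then show ?thesis using f by (intro smaller) (auto simp: down_kernel_def)
      next
        case (Suc j)
        define g where "g B = (if x \<in> B then 0 else f (insert x B))" for B
        have "g \<in> subset_funs N j"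
          unfolding subset_funs_def
        proof (intro CollectI allI impI)
          fix B assume "g B \<noteq> 0"
          then have B: "x \<notin> B" "f (insert x B) \<noteq> 0" by (auto simp: g_def split: if_splits)
          then have C: "insert x B \<subseteq> insert x N" "card (insert x B) = Suc j"
            using f(1) Suc by (auto simp: subset_funs_def)
          then have "finite B" using finite_subset[OF C(1)] insert.hyps(1) by simp
          then show "B \<subseteq> N \<and> card B = j" using B C by auto
        qed
        moreover have "down N g = 0"
        proof
          fix C
          show "down N g C = 0 C"
          proof (cases "x \<in> C")
            case True
            then show ?thesis by (simp add: down_def g_def)
          next
            case False
            have "down N g C = down (insert x N) f (insert x C)"
              unfolding down_def
            proof (rule sum.cong)
              show "N - C = insert x N - insert x C" using insert.hyps(2) by auto
              fix y assume "y \<in> insert x N - insert x C"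
              then show "g (insert y C) = f (insert y (insert x C))"
                using False by (auto simp: g_def insert_commute)
            qed
            then show ?thesis using f(2) by simp
          qed
        qed
        ultimately have "g \<in> down_kernel N j" by (simp add: down_kernel_def)
        moreover have "2 * j \<le> card N" using insert Suc by simp
        ultimately have "g \<in> fun_vs.span (pair_funs N j)" using insert.IH by blast
        then obtain h where h: "h \<in> ?S" "\<And>B. B \<subseteq> N \<Longrightarrow> h (insert x B) = g B"
          using span_pair_funs_lift[of g N j x] insert Suc by auto
        have hK: "h \<in> down_kernel (insert x N) k"
          using h(1) span_pair_funs_subset[of "insert x N" k] insert.hyps(1) by auto
        have "f - h \<in> ?S"
        proof (rule smaller)
          show fh: "f - h \<in> down_kernel (insert x N) k"
            using f hK subspace_down_kernel by (intro fun_vs.subspace_diff) (auto simp: down_kernel_def)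
          fix B assume xB: "x \<in> B"
          show "(f - h) B = 0"
          proof (cases "B \<subseteq> insert x N")
            case True
            have "insert x (B - {x}) = B" "B - {x} \<subseteq> N" using xB True by auto
            then show ?thesis using h(2)[of "B - {x}"] by (simp add: g_def)
          next
            case False
            then show ?thesis using fh unfolding down_kernel_def subset_funs_def by blast
          qed
        qed
        then have "(f - h) + h \<in> ?S" using h(1) by (rule fun_vs.span_add)
        then show ?thesis by simp
      qed
    qed
  qed
qed

section \<open>Column stabilizers and two-row polytabloids\<close>

definition pair_stabilizer :: "('v \<times> 'v) list \<Rightarrow> ('v \<Rightarrow> 'v) set" where
  "pair_stabilizer ps = {\<pi>. \<pi> permutes pair_set ps \<and> (\<forall>(a, b)\<in>set ps. \<pi> ` {a, b} = {a, b})}"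

lemma finite_pair_stabilizer: "finite (pair_stabilizer ps)"
  unfolding pair_stabilizer_def
  by (rule finite_subset[OF _ finite_permutations[OF finite_pair_set[of ps]]]) auto

text \<open>A permutation preserving {a, b} fixes both points or swaps them; composing with the
  transposition reduces the second case to the first.\<close>

lemma pair_stabilizer_Cons:
  assumes "disjoint_pairs ((a, b) # ps)"
  shows "pair_stabilizer ((a, b) # ps) =
           pair_stabilizer ps \<union> (\<lambda>\<pi>. transpose a b \<circ> \<pi>) ` pair_stabilizer ps"
    (is "?L = ?A \<union> ?B")
proof (intro equalityI subsetI)
  have ab: "a \<noteq> b" "a \<notin> pair_set ps" "b \<notin> pair_set ps"
    using assms by (auto simp: disjoint_pairs_Cons)
  {
    fix \<pi> assume "\<pi> \<in> ?L"
    then have p: "\<pi> permutes insert a (insert b (pair_set ps))" and pab: "\<pi> ` {a, b} = {a, b}"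
      and st: "\<And>c d. (c, d) \<in> set ps \<Longrightarrow> \<pi> ` {c, d} = {c, d}"
      by (auto simp: pair_stabilizer_def pair_set_Cons)
    show "\<pi> \<in> ?A \<union> ?B"
    proof (cases "\<pi> a = a")
      case True
      then have "\<pi> b = b" using pab permutes_inj[OF p] ab(1)
        by (metis image_insert insert_iff singletonD image_empty injD insertCI)
      then have "\<pi> permutes pair_set ps" using True by (intro permutes_superset[OF p]) auto
      then show ?thesis using st by (auto simp: pair_stabilizer_def)
    next
      case False
      then have pa: "\<pi> a = b" using pab by auto
      then have pb: "\<pi> b = a" using pab ab(1) by auto
      define \<sigma> where "\<sigma> = transpose a b \<circ> \<pi>"
      have s: "\<sigma> permutes insert a (insert b (pair_set ps))" unfolding \<sigma>_def
        using p by (intro permutes_compose[OF p] permutes_swap_id) auto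
      have "\<sigma> permutes pair_set ps"
        using pa pb by (intro permutes_superset[OF s]) (auto simp: \<sigma>_def)
      moreover have "\<sigma> ` {c, d} = {c, d}" if cd: "(c, d) \<in> set ps" for c d
      proof -
        have "c \<notin> {a, b}" "d \<notin> {a, b}" using pair_set_memI[OF cd] ab by auto
        then have "transpose a b ` {c, d} = {c, d}" by auto
        then show ?thesis unfolding \<sigma>_def image_comp[symmetric] st[OF cd] by simp
      qed
      ultimately have "\<sigma> \<in> pair_stabilizer ps" by (auto simp: pair_stabilizer_def)
      moreover have "\<pi> = transpose a b \<circ> \<sigma>" by (simp add: \<sigma>_def fun_eq_iff)
      ultimately show ?thesis by blast
    qed
  next
    fix \<pi> assume "\<pi> \<in> ?A \<union> ?B"
    then obtain \<sigma> \<tau> where \<pi>: "\<pi> = \<tau> \<circ> \<sigma>" and s: "\<sigma> \<in> pair_stabilizer ps" and \<tau>: "\<tau> = id \<or> \<tau> = transpose a b"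
      by (metis (no_types, lifting) UnE id_comp imageE)
    have sp: "\<sigma> permutes pair_set ps" and st: "\<And>c d. (c, d) \<in> set ps \<Longrightarrow> \<sigma> ` {c, d} = {c, d}"
      using s by (auto simp: pair_stabilizer_def)
    have "\<sigma> permutes insert a (insert b (pair_set ps))" by (rule permutes_subset[OF sp]) auto
    moreover have "\<tau> permutes insert a (insert b (pair_set ps))"
      using \<tau> permutes_id[of "insert a (insert b (pair_set ps))"] by (auto simp: id_def intro: permutes_swap_id)
    ultimately have "\<pi> permutes pair_set ((a, b) # ps)"
      unfolding \<pi> pair_set_Cons by (rule permutes_compose)
    moreover have "\<pi> ` {c, d} = {c, d}" if cd: "(c, d) \<in> set ((a, b) # ps)" for c d
    proof (cases "(c, d) = (a, b)")
      case True
      have "\<sigma> a = a" "\<sigma> b = b" using ab sp by (auto simp: permutes_not_in)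
      then show ?thesis using True \<tau> by (auto simp: \<pi>)
    next
      case False
      then have cd: "(c, d) \<in> set ps" using cd by auto
      have "c \<notin> {a, b}" "d \<notin> {a, b}" using pair_set_memI[OF cd] ab by auto
      then have "\<tau> ` {c, d} = {c, d}" using \<tau> by auto
      then show ?thesis unfolding \<pi> image_comp[symmetric] st[OF cd] by simp
    qed
    ultimately show "\<pi> \<in> ?L" by (auto simp: pair_stabilizer_def simp del: image_insert)
  }
qed

text \<open>The pairs are flipped independently, and a flip changes the sign and replaces b by a.
  The signed sum is thus the expanded product of the differences.\<close>

lemma signed_sum_pair_stabilizer:
  assumes "disjoint_pairs ps"
  shows "(\<Sum>\<pi>\<in>pair_stabilizer ps. of_int (sign \<pi>) * (\<Prod>(a, b)\<leftarrow>ps. of_bool (\<pi> b \<in> B))) = pair_prod ps B"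
  using assms
proof (induction ps)
  case Nil
  have "pair_stabilizer [] = {id :: 'a \<Rightarrow> 'a}" by (auto simp: pair_stabilizer_def pair_set_def)
  then show ?case by (simp add: pair_prod_def)
next
  case (Cons p ps)
  obtain a b where p: "p = (a, b)" by fastforce
  have dis: "disjoint_pairs ps" and ab: "a \<noteq> b" "a \<notin> pair_set ps" "b \<notin> pair_set ps"
    using Cons.prems p by (auto simp: disjoint_pairs_Cons)
  let ?\<tau> = "\<lambda>\<pi>. transpose a b \<circ> \<pi>" and ?G = "pair_stabilizer ps"
  let ?h = "\<lambda>ps \<pi>. of_int (sign \<pi>) * (\<Prod>(a, b)\<leftarrow>ps. of_bool (\<pi> b \<in> B)) :: complex"
  have perm: "\<pi> permutes pair_set ps" if "\<pi> \<in> ?G" for \<pi> using that by (simp add: pair_stabilizer_def)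
  have fixab: "\<pi> a = a" "\<pi> b = b" if "\<pi> \<in> ?G" for \<pi> using perm[OF that] ab by (auto simp: permutes_not_in)
  have inj: "inj_on ?\<tau> ?G"
  proof (rule inj_onI)
    fix \<pi> \<sigma> assume "?\<tau> \<pi> = ?\<tau> \<sigma>"
    then have "transpose a b (\<pi> u) = transpose a b (\<sigma> u)" for u by (simp add: fun_eq_iff)
    then show "\<pi> = \<sigma>" by (metis ext transpose_involutory)
  qed
  have disj: "?G \<inter> ?\<tau> ` ?G = {}"
  proof -
    have "?\<tau> \<pi> \<notin> ?G" if "\<pi> \<in> ?G" for \<pi>
      using that fixab(1)[of "?\<tau> \<pi>"] fixab(1)[of \<pi>] ab by auto
    then show ?thesis by blast
  qed
  have 1: "?h (p # ps) \<pi> = of_bool (b \<in> B) * ?h ps \<pi>" if "\<pi> \<in> ?G" for \<pi>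
    using fixab[OF that] p by simp
  have 2: "?h (p # ps) (?\<tau> \<pi>) = - of_bool (a \<in> B) * ?h ps \<pi>" if "\<pi> \<in> ?G" for \<pi>
  proof -
    have "permutation \<pi>" using perm[OF that] finite_pair_set permutation_permutes by blast
    then have "sign (?\<tau> \<pi>) = - sign \<pi>"
      using ab by (simp add: sign_compose permutation_swap_id sign_swap_id)
    moreover have "(\<Prod>(a', b')\<leftarrow>ps. of_bool (?\<tau> \<pi> b' \<in> B)) = (\<Prod>(a', b')\<leftarrow>ps. of_bool (\<pi> b' \<in> B) :: complex)"
    proof (intro arg_cong[where f = prod_list] map_cong refl)
      fix q assume "q \<in> set ps"
      then obtain c d where cd: "q = (c, d)" "(c, d) \<in> set ps" by (metis surj_pair)
      have "\<pi> d \<in> pair_set ps" using pair_set_memI[OF cd(2)] permutes_in_image[OF perm[OF that]] by auto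
      then have "\<pi> d \<noteq> a" "\<pi> d \<noteq> b" using ab by auto
      then have "?\<tau> \<pi> d = \<pi> d" by simp
      then show "(case q of (a', b') \<Rightarrow> of_bool (?\<tau> \<pi> b' \<in> B)) = (case q of (a', b') \<Rightarrow> (of_bool (\<pi> b' \<in> B) :: complex))"
        by (simp add: cd)
    qed
    ultimately show ?thesis using fixab[OF that] p by simp
  qed
  have "(\<Sum>\<pi>\<in>pair_stabilizer (p # ps). ?h (p # ps) \<pi>) = (\<Sum>\<pi>\<in>?G \<union> ?\<tau> ` ?G. ?h (p # ps) \<pi>)"
    using pair_stabilizer_Cons[of a b ps] Cons.prems p by simp
  also have "\<dots> = sum (?h (p # ps)) ?G + sum (?h (p # ps)) (?\<tau> ` ?G)"
    using finite_pair_stabilizer disj by (intro sum.union_disjoint) auto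
  also have "sum (?h (p # ps)) (?\<tau> ` ?G) = (\<Sum>\<pi>\<in>?G. ?h (p # ps) (?\<tau> \<pi>))"
    using inj by (simp only: sum.reindex o_def[of "?h (p # ps)"])
  also have "\<dots> = (\<Sum>\<pi>\<in>?G. - of_bool (a \<in> B) * ?h ps \<pi>)" by (intro sum.cong refl 2)
  also have "sum (?h (p # ps)) ?G = (\<Sum>\<pi>\<in>?G. of_bool (b \<in> B) * ?h ps \<pi>)" by (intro sum.cong refl 1)
  also have "(\<Sum>\<pi>\<in>?G. of_bool (b \<in> B) * ?h ps \<pi>) + (\<Sum>\<pi>\<in>?G. - of_bool (a \<in> B) * ?h ps \<pi>)
      = (of_bool (b \<in> B) - of_bool (a \<in> B)) * (\<Sum>\<pi>\<in>?G. ?h ps \<pi>)"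
    by (simp only: sum_distrib_left[symmetric] distrib_right[symmetric] add_uminus_conv_diff)
  also have "\<dots> = pair_prod (p # ps) B"
    unfolding Cons.IH[OF dis] p pair_prod_Cons ..
  finally show ?case .
qed

text \<open>Both sets have as many elements as there are pairs, so equality is inclusion, and the
  indicator of inclusion factors over the pairs.\<close>

lemma signed_sum_pair_fun:
  assumes dis: "disjoint_pairs ps"
  shows "(\<Sum>\<pi>\<in>pair_stabilizer ps. of_int (sign \<pi>) * of_bool (\<pi> ` snd ` set ps = B)) = pair_fun ps B"
proof -
  have card: "card (\<pi> ` snd ` set ps) = length ps" and sub: "\<pi> ` snd ` set ps \<subseteq> pair_set ps"
    if "\<pi> \<in> pair_stabilizer ps" for \<pi>
  proof -
    have perm: "\<pi> permutes pair_set ps" using that by (simp add: pair_stabilizer_def)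
    have "card (snd ` set ps) = length ps"
      using dis distinct_card[of "map snd ps"] by (simp add: disjoint_pairs_def)
    then show "card (\<pi> ` snd ` set ps) = length ps"
      using card_image[OF inj_on_subset[OF permutes_inj[OF perm]], of "snd ` set ps"] by simp
    have "\<pi> ` snd ` set ps \<subseteq> \<pi> ` pair_set ps" by (intro image_mono) (auto simp: pair_set_def)
    then show "\<pi> ` snd ` set ps \<subseteq> pair_set ps" using permutes_image[OF perm] by simp
  qed
  show ?thesis
  proof (cases "B \<subseteq> pair_set ps \<and> card B = length ps")
    case False
    then have "\<pi> ` snd ` set ps \<noteq> B" if "\<pi> \<in> pair_stabilizer ps" for \<pi>
      using card[OF that] sub[OF that] by blast
    then show ?thesis using False by (auto simp: pair_fun_def)
  next
    case True
    then have fin: "finite B" using finite_pair_set finite_subset by blast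
    have "of_bool (\<pi> ` snd ` set ps = B) = (\<Prod>(a, b)\<leftarrow>ps. of_bool (\<pi> b \<in> B) :: complex)"
      if "\<pi> \<in> pair_stabilizer ps" for \<pi>
    proof -
      have "\<pi> ` snd ` set ps = B \<longleftrightarrow> \<pi> ` snd ` set ps \<subseteq> B"
        using card[OF that] True fin card_subset_eq by (metis subset_refl)
      also have "\<dots> \<longleftrightarrow> (\<forall>(a, b)\<in>set ps. \<pi> b \<in> B)" by (auto simp: case_prod_unfold)
      also have "of_bool \<dots> = (\<Prod>(a, b)\<leftarrow>ps. of_bool (\<pi> b \<in> B) :: complex)"
        by (induction ps) (simp_all add: case_prod_unfold of_bool_conj)
      finally show ?thesis .
    qed
    then have "(\<Sum>\<pi>\<in>pair_stabilizer ps. of_int (sign \<pi>) * of_bool (\<pi> ` snd ` set ps = B)) = pair_prod ps B"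
      unfolding signed_sum_pair_stabilizer[OF dis, of B, symmetric] by (intro sum.cong refl) simp
    then show ?thesis using True by (simp add: pair_fun_def)
  qed
qed

text \<open>A two-row tabloid is determined by its second row. The test on X also forces X to have
  length two.\<close>

definition tabloid_lift :: "nat \<Rightarrow> (nat set \<Rightarrow> complex) \<Rightarrow> tabloid \<Rightarrow> complex" where
  "tabloid_lift n f X = (if X = [{0..<n} - X ! 1, X ! 1] then f (X ! 1) else 0)"

lemma fun_linear_tabloid_lift: "fun_linear (tabloid_lift n)"
  by (auto simp: fun_linear_iff tabloid_lift_def fun_scale_def fun_eq_iff)

lemma column_two_rows:
  assumes "length r1 = m" "length r2 = k" "k \<le> m"
  shows "column [r1, r2] j = (if j < k then {r1 ! j, r2 ! j} else if j < m then {r1 ! j} else {})"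
  using assms by (auto simp: column_def)

lemma two_row_tableau_cases:
  assumes "t \<in> tableaux [n - k, k]" "2 * k \<le> n"
  obtains r1 r2 where "t = [r1, r2]" "length r1 = n - k" "length r2 = k" "distinct (r1 @ r2)"
    "set r1 \<union> set r2 = {0..<n}"
proof -
  have l: "map length t = [n - k, k]" "distinct (concat t)" "set (concat t) = {0..<n}"
    using assms by (auto simp: tableaux_def)
  then obtain r1 r2 where t: "t = [r1, r2]" by (auto simp: map_eq_Cons_conv)
  show ?thesis using that[OF t] l by (simp add: t)
qed

text \<open>Columns from k on are single cells, so their entries are fixed; the first k columns are
  the pairs of the zip.\<close>

lemma column_stabilizer_two_rows:
  assumes r: "length r1 = n - k" "length r2 = k" "distinct (r1 @ r2)" "set r1 \<union> set r2 = {0..<n}"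
    and k: "2 * k \<le> n"
  shows "column_stabilizer [r1, r2] = pair_stabilizer (zip r1 r2)"
proof -
  let ?ps = "zip r1 r2"
  have km: "k \<le> n - k" using k by simp
  note col = column_two_rows[OF r(1,2) km]
  have in_zip: "(c, d) \<in> set ?ps \<longleftrightarrow> (\<exists>j<k. c = r1 ! j \<and> d = r2 ! j)" for c d
    using r(1,2) km by (auto simp: set_zip)
  have "map snd ?ps = r2" "map fst ?ps = take k r1"
    using r(1,2) km by (simp_all add: map_snd_zip_take map_fst_zip_take)
  then have snd: "snd ` set ?ps = set r2" and fst: "fst ` set ?ps = set (take k r1)"
    by (metis list.set_map)+
  have sub: "pair_set ?ps \<subseteq> {0..<n}"
    unfolding pair_set_def snd fst using r(4) set_take_subset[of k r1] by blast
  have outside: "\<exists>j. k \<le> j \<and> j < n - k \<and> x = r1 ! j" if x: "x \<in> {0..<n} - pair_set ?ps" for x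
  proof -
    have "x \<in> set r1" "x \<notin> set (take k r1)" using x r(4) snd fst by (auto simp: pair_set_def)
    then obtain j where j: "j < length r1" "x = r1 ! j" by (auto simp: in_set_conv_nth)
    then have "\<not> j < k" using \<open>x \<notin> set (take k r1)\<close> by (auto simp: in_set_conv_nth)
    then show ?thesis using j r(1) by (intro exI[of _ j]) auto
  qed
  have not_in: "r1 ! j \<notin> pair_set ?ps" if j: "k \<le> j" "j < n - k" for j
  proof -
    have "r1 ! j \<in> set (drop k r1)" using nth_mem[of "j - k" "drop k r1"] j r(1) by simp
    moreover have "set (take k r1) \<inter> set (drop k r1) = {}" using r(3) by (simp add: set_take_disj_set_drop_if_distinct)
    moreover have "r1 ! j \<in> set r1" "set r1 \<inter> set r2 = {}" using j r(1,3) by auto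
    then have "r1 ! j \<notin> set r2" by blast
    ultimately show ?thesis using snd fst unfolding pair_set_def by blast
  qed
  show ?thesis
  proof (intro equalityI subsetI)
    fix \<pi> assume "\<pi> \<in> column_stabilizer [r1, r2]"
    then have p: "\<pi> permutes {0..<n}" and c: "\<And>j. \<pi> ` column [r1, r2] j = column [r1, r2] j"
      using r(4) by (auto simp: column_stabilizer_def)
    have "\<pi> permutes pair_set ?ps"
    proof (rule permutes_superset[OF p])
      fix x assume "x \<in> {0..<n} - pair_set ?ps"
      then obtain j where "k \<le> j" "j < n - k" "x = r1 ! j" using outside by blast
      then show "\<pi> x = x" using c[of j] by (simp add: col)
    qed
    moreover have "\<pi> ` {a, b} = {a, b}" if ab: "(a, b) \<in> set ?ps" for a b
    proof -
      obtain j where "j < k" "a = r1 ! j" "b = r2 ! j" using in_zip[THEN iffD1, OF ab] by blast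
      then have "column [r1, r2] j = {a, b}" by (simp add: col)
      then show ?thesis using c[of j] by simp
    qed
    ultimately show "\<pi> \<in> pair_stabilizer ?ps" by (auto simp: pair_stabilizer_def simp del: image_insert)
  next
    fix \<pi> assume "\<pi> \<in> pair_stabilizer ?ps"
    then have p: "\<pi> permutes pair_set ?ps"
      and all: "\<forall>x\<in>set ?ps. case x of (a, b) \<Rightarrow> \<pi> ` {a, b} = {a, b}"
      unfolding pair_stabilizer_def by blast+
    have c: "\<pi> ` {a, b} = {a, b}" if "(a, b) \<in> set ?ps" for a b
      using bspec[OF all that] by simp
    have "\<pi> ` column [r1, r2] j = column [r1, r2] j" for j
    proof -
      consider "j < k" | "k \<le> j" "j < n - k" | "n - k \<le> j" by linarith
      then show ?thesis
      proof cases
        case 1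
        then have "\<pi> ` {r1 ! j, r2 ! j} = {r1 ! j, r2 ! j}" using in_zip by (intro c) auto
        with 1 show ?thesis by (simp add: col)
      next
        case 2
        then show ?thesis using permutes_not_in[OF p not_in[OF 2]] by (simp add: col)
      qed (use km in \<open>auto simp: col\<close>)
    qed
    then show "\<pi> \<in> column_stabilizer [r1, r2]"
      using permutes_subset[OF p sub] r(4) by (auto simp: column_stabilizer_def)
  qed
qed

lemma polytabloid_two_rows:
  assumes r: "length r1 = n - k" "length r2 = k" "distinct (r1 @ r2)" "set r1 \<union> set r2 = {0..<n}"
    and k: "2 * k \<le> n"
  shows "disjoint_pairs (zip r1 r2)" "pair_set (zip r1 r2) \<subseteq> {0..<n}" "length (zip r1 r2) = k"
    "polytabloid [r1, r2] = tabloid_lift n (pair_fun (zip r1 r2))"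
proof -
  let ?ps = "zip r1 r2"
  have km: "k \<le> n - k" using k by simp
  have snd: "map snd ?ps = r2" using r(1,2) km by (simp add: map_snd_zip_take)
  have fst: "map fst ?ps = take k r1" using r(1,2) km by (simp add: map_fst_zip_take)
  show dis: "disjoint_pairs ?ps"
    unfolding disjoint_pairs_def fst snd using r(3) by (auto dest: in_set_takeD)
  show "length ?ps = k" using r(1,2) km by simp
  have snd': "snd ` set ?ps = set r2" and fst': "fst ` set ?ps = set (take k r1)"
    using snd fst by (metis list.set_map)+
  show sub: "pair_set ?ps \<subseteq> {0..<n}"
    unfolding pair_set_def snd' fst' using r(4) set_take_subset[of k r1] by blast
  have s1: "set r1 = {0..<n} - set r2" using r(3,4) by auto
  show "polytabloid [r1, r2] = tabloid_lift n (pair_fun ?ps)"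
  proof
    fix X
    have "of_int (sign \<pi>) * (if tabloid_of (map (map \<pi>) [r1, r2]) = X then 1 else 0) =
        (if X = [{0..<n} - X ! 1, X ! 1] then of_int (sign \<pi>) * of_bool (\<pi> ` snd ` set ?ps = X ! 1) else 0 :: complex)"
      if "\<pi> \<in> pair_stabilizer ?ps" for \<pi>
    proof -
      have p: "\<pi> permutes {0..<n}"
        using that permutes_subset[OF _ sub] by (auto simp: pair_stabilizer_def)
      have "\<pi> ` set r1 = {0..<n} - \<pi> ` set r2"
        unfolding s1 image_set_diff[OF permutes_inj[OF p]] permutes_image[OF p] ..
      then have "tabloid_of (map (map \<pi>) [r1, r2]) = [{0..<n} - \<pi> ` set r2, \<pi> ` set r2]"
        by (simp add: tabloid_of_def)
      then show ?thesis unfolding snd' by auto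
    qed
    then have "polytabloid [r1, r2] X = (\<Sum>\<pi>\<in>pair_stabilizer ?ps. if X = [{0..<n} - X ! 1, X ! 1]
        then of_int (sign \<pi>) * of_bool (\<pi> ` snd ` set ?ps = X ! 1) else 0)"
      unfolding polytabloid_def column_stabilizer_two_rows[OF r k] by (intro sum.cong refl)
    also have "\<dots> = tabloid_lift n (pair_fun ?ps) X"
      unfolding tabloid_lift_def signed_sum_pair_fun[OF dis, symmetric] by simp
    finally show "polytabloid [r1, r2] X = tabloid_lift n (pair_fun ?ps) X" .
  qed
qed

lemma specht_module_two_rows:
  assumes k: "2 * k \<le> n"
  shows "specht_module [n - k, k] = tabloid_lift n ` down_kernel {0..<n} k"
proof -
  have "polytabloid ` tableaux [n - k, k] = tabloid_lift n ` pair_funs {0..<n} k"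
  proof (intro equalityI subsetI)
    fix e assume "e \<in> polytabloid ` tableaux [n - k, k]"
    then obtain t where t: "t \<in> tableaux [n - k, k]" "e = polytabloid t" by auto
    obtain r1 r2 where r: "t = [r1, r2]" "length r1 = n - k" "length r2 = k" "distinct (r1 @ r2)"
      "set r1 \<union> set r2 = {0..<n}" using two_row_tableau_cases[OF t(1) k] by metis
    note P = polytabloid_two_rows[OF r(2-5) k]
    have "pair_fun (zip r1 r2) \<in> pair_funs {0..<n} k" unfolding pair_funs_def using P(1-3) by blast
    then show "e \<in> tabloid_lift n ` pair_funs {0..<n} k" using P(4) t(2) r(1) by blast
  next
    fix e assume "e \<in> tabloid_lift n ` pair_funs {0..<n} k"
    then obtain ps where ps: "disjoint_pairs ps" "pair_set ps \<subseteq> {0..<n}" "length ps = k"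
      and e: "e = tabloid_lift n (pair_fun ps)" by (auto simp: pair_funs_def)
    \<comment> \<open>A tableau with the given pairs as its first k columns: the unpaired points
      fill the rest of the first row, in any order.\<close>
    define xs where "xs = sorted_list_of_set ({0..<n} - pair_set ps)"
    define r1 where "r1 = map fst ps @ xs"
    define r2 where "r2 = map snd ps"
    have xs: "set xs = {0..<n} - pair_set ps" "distinct xs" by (simp_all add: xs_def)
    have sets: "set r1 \<union> set r2 = {0..<n}" using xs ps(2) by (auto simp: r1_def r2_def pair_set_def)
    have dis: "distinct (r1 @ r2)"
      using ps(1) xs by (auto simp: r1_def r2_def disjoint_pairs_def pair_set_def)
    have l2: "length r2 = k" using ps(3) by (simp add: r2_def)
    have "length (r1 @ r2) = n" using distinct_card[OF dis] sets by simp
    then have l1: "length r1 = n - k" using l2 by simp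
    have "zip r1 r2 = ps" by (simp add: r1_def r2_def zip_append1 zip_map_fst_snd)
    then have "e = polytabloid [r1, r2]"
      using polytabloid_two_rows(4)[OF l1 l2 dis sets k] e by simp
    moreover have "[r1, r2] \<in> tableaux [n - k, k]"
      using l1 l2 dis sets k by (simp add: tableaux_def)
    ultimately show "e \<in> polytabloid ` tableaux [n - k, k]" by blast
  qed
  then have "specht_module [n - k, k] = tabloid_lift n ` fun_vs.span (pair_funs {0..<n} k)"
    unfolding specht_module_def by (simp add: module_hom.span_image[OF fun_linear_tabloid_lift])
  then show ?thesis using down_kernel_eq_span[of "{0..<n}" k] k by simp
qed

section \<open>Two-row characters as differences of fixed-point counts\<close>

definition fixed_subsets :: "(nat \<Rightarrow> nat) \<Rightarrow> nat set \<Rightarrow> nat \<Rightarrow> nat set set" where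
  "fixed_subsets \<pi> N k = {B. B \<subseteq> N \<and> card B = k \<and> \<pi> ` B = B}"

lemma perm_action_tabloid_lift:
  assumes p: "\<pi> permutes {0..<n}"
  shows "perm_action \<pi> (tabloid_lift n f) = tabloid_lift n (\<lambda>B. f (inv_into UNIV \<pi> ` B))"
proof
  fix X :: tabloid
  let ?\<rho> = "inv_into UNIV \<pi>"
  have r: "?\<rho> permutes {0..<n}" using permutes_inv[OF p] .
  have inj: "inj ?\<rho>" using permutes_inj[OF r] .
  have diff: "?\<rho> ` ({0..<n} - B) = {0..<n} - ?\<rho> ` B" for B
    unfolding image_set_diff[OF inj] permutes_image[OF r] ..
  have iff: "map ((`) ?\<rho>) X = [{0..<n} - map ((`) ?\<rho>) X ! 1, map ((`) ?\<rho>) X ! 1]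
      \<longleftrightarrow> X = [{0..<n} - X ! 1, X ! 1]"
  proof (cases "length X = 2")
    case True
    then obtain A B where X: "X = [A, B]" by (auto simp: numeral_2_eq_2 length_Suc_conv)
    have "?\<rho> ` A = {0..<n} - ?\<rho> ` B \<longleftrightarrow> A = {0..<n} - B"
      unfolding diff[symmetric] by (rule inj_image_eq_iff[OF inj])
    then show ?thesis by (simp add: X)
  next
    case False
    have "length (map ((`) ?\<rho>) X) \<noteq> 2" using False by simp
    then show ?thesis using False by (metis length_Cons list.size(3) numeral_2_eq_2)
  qed
  show "perm_action \<pi> (tabloid_lift n f) X = tabloid_lift n (\<lambda>B. f (?\<rho> ` B)) X"
  proof (cases "X = [{0..<n} - X ! 1, X ! 1]")
    case True
    then have "length X = 2" by (metis length_Cons list.size(3) numeral_2_eq_2)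
    then have "map ((`) ?\<rho>) X ! 1 = ?\<rho> ` (X ! 1)" by simp
    with True iff show ?thesis unfolding perm_action_def tabloid_lift_def by simp
  next
    case False
    with iff show ?thesis unfolding perm_action_def tabloid_lift_def by simp
  qed
qed

lemma down_permuted:
  assumes "\<rho> permutes N"
  shows "down N (\<lambda>B. f (\<rho> ` B)) C = down N f (\<rho> ` C)"
proof -
  have "\<rho> ` (N - C) = N - \<rho> ` C"
    using image_set_diff[OF permutes_inj[OF assms]] permutes_image[OF assms] by metis
  then have "down N f (\<rho> ` C) = (\<Sum>y\<in>\<rho> ` (N - C). f (insert y (\<rho> ` C)))" by (simp add: down_def)
  also have "\<dots> = (\<Sum>y\<in>N - C. f (insert (\<rho> y) (\<rho> ` C)))"
    using permutes_inj[OF assms] by (subst sum.reindex) (auto intro: inj_on_subset)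
  finally show ?thesis by (simp add: down_def)
qed

lemma down_kernel_permuted:
  assumes p: "\<rho> permutes N" and f: "f \<in> down_kernel N k"
  shows "(\<lambda>B. f (\<rho> ` B)) \<in> down_kernel N k"
proof -
  have "B \<subseteq> N \<and> card B = k" if "f (\<rho> ` B) \<noteq> 0" for B
  proof -
    have "\<rho> ` B \<subseteq> N" "card (\<rho> ` B) = k" using f that by (auto simp: down_kernel_def subset_funs_def)
    moreover have "card (\<rho> ` B) = card B" using permutes_inj[OF p] by (intro card_image) (auto intro: inj_on_subset)
    moreover have "B \<subseteq> N" using calculation(1) permutes_in_image[OF p] by auto
    ultimately show ?thesis by simp
  qed
  moreover have "down N (\<lambda>B. f (\<rho> ` B)) = 0"
  proof
    fix C show "down N (\<lambda>B. f (\<rho> ` B)) C = 0 C"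
      unfolding down_permuted[OF p] using f by (simp add: down_kernel_def)
  qed
  ultimately show ?thesis by (simp add: down_kernel_def subset_funs_def)
qed

text \<open>\<open>P\<close> acts as 1 - S down on second rows, which maps onto the kernel of down
  and fixes it pointwise. The 1 gives the permutation character on (k + 1)-subsets. In the other
  term S down is cycled to down S = 1 on k-subsets, which needs the permutation to commute with down
  but not with S.\<close>

lemma irr_char_two_rows:
  assumes k: "2 * Suc k \<le> n" and p: "\<pi> permutes {0..<n}"
  shows "irr_char [n - Suc k, Suc k] \<pi> =
           of_nat (card (fixed_subsets \<pi> {0..<n} (Suc k))) - of_nat (card (fixed_subsets \<pi> {0..<n} k))"
proof -
  let ?N = "{0..<n}" and ?\<rho> = "inv_into UNIV \<pi>"
  let ?Sub = "\<lambda>k. {B. B \<subseteq> ?N \<and> card B = k}"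
  let ?T = "\<lambda>B. [?N - B, B]"
  let ?V = "specht_module [n - Suc k, Suc k]"
  have N: "finite ?N" "2 * k < card ?N" using k by auto
  have finSub: "finite (?Sub k)" for k by (rule finite_subset[of _ "Pow ?N"]) auto
  have r: "?\<rho> permutes ?N" using permutes_inv[OF p] .
  have V: "?V = tabloid_lift n ` down_kernel ?N (Suc k)" using specht_module_two_rows[OF k] .
  obtain S where S: "fun_linear S" "\<And>f. f \<in> subset_funs ?N k \<Longrightarrow> S f \<in> subset_funs ?N (Suc k)"
    "\<And>f. f \<in> subset_funs ?N k \<Longrightarrow> down ?N (S f) = f"
    using down_right_inverse[OF N] by blast
  define res where "res h = (\<lambda>B. if B \<in> ?Sub (Suc k) then h (?T B) else 0)" for h :: "tabloid \<Rightarrow> complex"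
  define P0 where "P0 f = f - S (down ?N f)" for f
  define P where "P h = tabloid_lift n (P0 (res h))" for h
  have res_in: "res h \<in> subset_funs ?N (Suc k)" for h by (auto simp: res_def subset_funs_def split: if_splits)
  have res_lift: "res (tabloid_lift n f) = f" if "f \<in> subset_funs ?N (Suc k)" for f
  proof
    fix B show "res (tabloid_lift n f) B = f B"
      using that by (cases "B \<in> ?Sub (Suc k)") (auto simp: res_def tabloid_lift_def subset_funs_def)
  qed
  have P0_in: "P0 f \<in> down_kernel ?N (Suc k)" if f: "f \<in> subset_funs ?N (Suc k)" for f
  proof -
    have d: "down ?N f \<in> subset_funs ?N k" using down_in_subset_funs[OF N(1) f] .
    have "P0 f \<in> subset_funs ?N (Suc k)"
      unfolding P0_def using f S(2)[OF d] subspace_subset_funs by (intro fun_vs.subspace_diff)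
    moreover have "down ?N (P0 f) = 0" unfolding P0_def down_simps S(3)[OF d] by simp
    ultimately show ?thesis by (simp add: down_kernel_def)
  qed
  have P0_id: "P0 f = f" if "f \<in> down_kernel ?N (Suc k)" for f
    using that by (simp add: P0_def down_kernel_def module_hom.zero[OF S(1)])
  have res_lin: "fun_linear res" by (auto simp: fun_linear_iff res_def fun_scale_def fun_eq_iff)
  have P0_lin: "fun_linear P0"
    unfolding fun_linear_iff P0_def down_simps module_hom.add[OF S(1)] module_hom.scale[OF S(1)]
    by (auto simp: fun_scale_def fun_eq_iff algebra_simps)
  have P_lin: "fun_linear P"
    using module_hom_compose[OF module_hom_compose[OF res_lin P0_lin] fun_linear_tabloid_lift[of n]]
    by (simp add: P_def[abs_def] o_def)
  have "irr_char [n - Suc k, Suc k] \<pi> = (\<Sum>X\<in>?T ` ?Sub (Suc k). perm_action \<pi> (P (point_fun X)) X)"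
    unfolding irr_char_def
  proof (rule trace_on_projection)
    show "finite (?T ` ?Sub (Suc k))" using finSub by simp
    show "v X = 0" if v: "v \<in> ?V" "X \<notin> ?T ` ?Sub (Suc k)" for v X
    proof -
      obtain f where f: "v = tabloid_lift n f" "f \<in> subset_funs ?N (Suc k)"
        using v(1) V by (auto simp: down_kernel_def)
      show ?thesis
      proof (rule ccontr)
        assume "v X \<noteq> 0"
        then have X: "X = ?T (X ! 1)" and "f (X ! 1) \<noteq> 0" by (auto simp: f(1) tabloid_lift_def split: if_splits)
        then have "X ! 1 \<in> ?Sub (Suc k)" using f(2) by (simp add: subset_funs_def)
        then show False using X v(2) by blast
      qed
    qed
    show "fun_vs.subspace ?V" by (simp add: specht_module_def)
    show "fun_linear P" by (rule P_lin)
    show "P h \<in> ?V" for h unfolding P_def V by (intro imageI P0_in res_in)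
    show "P v = v" if "v \<in> ?V" for v
    proof -
      obtain f where f: "v = tabloid_lift n f" "f \<in> down_kernel ?N (Suc k)" using \<open>v \<in> ?V\<close> V by auto
      then have "res v = f" using res_lift by (simp add: down_kernel_def)
      then show ?thesis using f P0_id by (simp add: P_def)
    qed
    show "fun_linear (perm_action \<pi>)" by (auto simp: fun_linear_iff perm_action_def fun_scale_def fun_eq_iff)
    show "perm_action \<pi> v \<in> ?V" if "v \<in> ?V" for v
    proof -
      obtain f where f: "v = tabloid_lift n f" "f \<in> down_kernel ?N (Suc k)" using \<open>v \<in> ?V\<close> V by auto
      show ?thesis unfolding f(1) perm_action_tabloid_lift[OF p] V
        by (intro imageI down_kernel_permuted[OF r f(2)])
    qed
  qed
  also have "\<dots> = (\<Sum>B\<in>?Sub (Suc k). perm_action \<pi> (P (point_fun (?T B))) (?T B))"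
    by (subst sum.reindex) (auto simp: inj_on_def)
  also have "\<dots> = (\<Sum>B\<in>?Sub (Suc k). point_fun B (?\<rho> ` B) - S (down ?N (point_fun B)) (?\<rho> ` B))"
  proof (intro sum.cong refl)
    fix B assume B: "B \<in> ?Sub (Suc k)"
    have "res (point_fun (?T B)) = point_fun B"
      using B by (auto simp: res_def point_fun_def fun_eq_iff)
    then show "perm_action \<pi> (P (point_fun (?T B))) (?T B) =
        point_fun B (?\<rho> ` B) - S (down ?N (point_fun B)) (?\<rho> ` B)"
      unfolding P_def perm_action_tabloid_lift[OF p] by (simp add: tabloid_lift_def P0_def)
  qed
  also have "\<dots> = (\<Sum>B\<in>?Sub (Suc k). point_fun B (?\<rho> ` B)) - (\<Sum>B\<in>?Sub (Suc k). S (down ?N (point_fun B)) (?\<rho> ` B))"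
    by (rule sum_subtractf)
  \<comment> \<open>Cyclicity of the trace, written out by expanding
    \<open>down ?N (point_fun B)\<close> in point functions of k-subsets and exchanging the
    sums.\<close>
  also have "(\<Sum>B\<in>?Sub (Suc k). S (down ?N (point_fun B)) (?\<rho> ` B)) = (\<Sum>C\<in>?Sub k. point_fun C (?\<rho> ` C))"
  proof -
    have "S (down ?N (point_fun B)) (?\<rho> ` B) = (\<Sum>C\<in>?Sub k. down ?N (point_fun B) C * S (point_fun C) (?\<rho> ` B))"
      if B: "B \<in> ?Sub (Suc k)" for B
    proof -
      have "point_fun B \<in> subset_funs ?N (Suc k)" using B by (auto simp: subset_funs_def point_fun_def)
      then have "down ?N (point_fun B) \<in> subset_funs ?N k" by (rule down_in_subset_funs[OF N(1)])
      then have "down ?N (point_fun B) C = 0" if "C \<notin> ?Sub k" for C using that by (auto simp: subset_funs_def)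
      then have e: "down ?N (point_fun B) = (\<Sum>C\<in>?Sub k. fun_scale (down ?N (point_fun B) C) (point_fun C))"
        using finSub by (intro finite_support_expansion)
      have "S (down ?N (point_fun B)) = (\<Sum>C\<in>?Sub k. fun_scale (down ?N (point_fun B) C) (S (point_fun C)))"
        by (subst e) (simp only: module_hom.sum[OF S(1)] module_hom.scale[OF S(1)])
      then show ?thesis by (simp only: sum_fun_apply) (simp only: fun_scale_def)
    qed
    then have "(\<Sum>B\<in>?Sub (Suc k). S (down ?N (point_fun B)) (?\<rho> ` B)) =
        (\<Sum>B\<in>?Sub (Suc k). \<Sum>C\<in>?Sub k. down ?N (point_fun B) C * S (point_fun C) (?\<rho> ` B))"
      by (intro sum.cong refl)
    also have "\<dots> = (\<Sum>C\<in>?Sub k. \<Sum>B\<in>?Sub (Suc k). down ?N (point_fun B) C * S (point_fun C) (?\<rho> ` B))"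
      by (rule sum.swap)
    also have "\<dots> = (\<Sum>C\<in>?Sub k. point_fun C (?\<rho> ` C))"
    proof (intro sum.cong refl)
      fix C assume C: "C \<in> ?Sub k"
      then have finC: "finite C" using finite_subset by blast
      have "(\<Sum>B\<in>?Sub (Suc k). down ?N (point_fun B) C * S (point_fun C) (?\<rho> ` B)) =
          (\<Sum>B\<in>?Sub (Suc k). \<Sum>y\<in>?N - C. point_fun B (insert y C) * S (point_fun C) (?\<rho> ` B))"
        by (simp only: down_def sum_distrib_right)
      also have "\<dots> = (\<Sum>y\<in>?N - C. \<Sum>B\<in>?Sub (Suc k). point_fun B (insert y C) * S (point_fun C) (?\<rho> ` B))"
        by (rule sum.swap)
      also have "\<dots> = (\<Sum>y\<in>?N - C. S (point_fun C) (?\<rho> ` insert y C))"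
      proof (intro sum.cong refl)
        fix y assume y: "y \<in> ?N - C"
        have "insert y C \<in> ?Sub (Suc k)" using y C finC by auto
        moreover have "(\<Sum>B\<in>?Sub (Suc k). point_fun B (insert y C) * S (point_fun C) (?\<rho> ` B)) =
            (\<Sum>B\<in>?Sub (Suc k). if insert y C = B then S (point_fun C) (?\<rho> ` B) else 0)"
          by (intro sum.cong refl) (simp add: point_fun_def)
        ultimately show "(\<Sum>B\<in>?Sub (Suc k). point_fun B (insert y C) * S (point_fun C) (?\<rho> ` B)) =
            S (point_fun C) (?\<rho> ` insert y C)"
          using finSub[of "Suc k"] by (simp only: sum.delta) simp
      qed
      also have "\<dots> = down ?N (\<lambda>B. S (point_fun C) (?\<rho> ` B)) C" by (simp only: down_def)
      also have "\<dots> = down ?N (S (point_fun C)) (?\<rho> ` C)" by (rule down_permuted[OF r])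
      also have "\<dots> = point_fun C (?\<rho> ` C)"
        using C by (subst S(3)) (auto simp: subset_funs_def point_fun_def)
      finally show "(\<Sum>B\<in>?Sub (Suc k). down ?N (point_fun B) C * S (point_fun C) (?\<rho> ` B)) = point_fun C (?\<rho> ` C)" .
    qed
    finally show ?thesis .
  qed
  finally have main: "irr_char [n - Suc k, Suc k] \<pi> =
    (\<Sum>B\<in>?Sub (Suc k). point_fun B (?\<rho> ` B)) - (\<Sum>C\<in>?Sub k. point_fun C (?\<rho> ` C))" .
  have count: "(\<Sum>B\<in>?Sub j. point_fun B (?\<rho> ` B)) = of_nat (card (fixed_subsets \<pi> ?N j))" for j
  proof -
    have fix_iff: "?\<rho> ` B = B \<longleftrightarrow> \<pi> ` B = B" for B
      by (metis bij_image_Collect_eq image_inv_f_f image_f_inv_f permutes_inj[OF p] permutes_surj[OF p])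
    have "(\<Sum>B\<in>?Sub j. point_fun B (?\<rho> ` B)) = (\<Sum>B\<in>?Sub j. if \<pi> ` B = B then 1 else 0)"
      by (intro sum.cong refl) (simp add: point_fun_def fix_iff)
    also have "\<dots> = of_nat (card {B \<in> ?Sub j. \<pi> ` B = B})"
      using finSub[of j] by (simp add: sum.If_cases Int_def conj_ac)
    also have "{B \<in> ?Sub j. \<pi> ` B = B} = fixed_subsets \<pi> ?N j" by (auto simp: fixed_subsets_def)
    finally show ?thesis .
  qed
  show ?thesis unfolding main count ..
qed

text \<open>An invariant subset is a union of orbits, and an orbit of size s contributes a factor 1
  + x^s. The induction removes the orbit of one point, which also gives the parity.\<close>

lemma involution_fixed_subsets:
  fixes x :: "'a :: comm_ring_1"
  assumes "finite V" "\<And>v. v \<in> V \<Longrightarrow> \<pi> v \<in> V \<and> \<pi> (\<pi> v) = v"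
  shows "even (card {v \<in> V. \<pi> v \<noteq> v}) \<and> (\<Sum>B | B \<subseteq> V \<and> \<pi> ` B = B. x ^ card B) =
           (1 + x) ^ card {v \<in> V. \<pi> v = v} * (1 + x\<^sup>2) ^ (card {v \<in> V. \<pi> v \<noteq> v} div 2)"
  using assms
proof (induction "card V" arbitrary: V rule: less_induct)
  case less
  show ?case
  proof (cases "V = {}")
    case True
    have "{B. B \<subseteq> {} \<and> \<pi> ` B = B} = {{}}" by auto
    then show ?thesis by (simp add: True)
  next
    case False
    then obtain v where v: "v \<in> V" by auto
    let ?O = "{v, \<pi> v}"
    let ?W = "V - ?O"
    have W: "finite ?W" "card ?W < card V" using less.prems(1) v by (auto intro!: psubset_card_mono)
    have inv: "\<pi> u \<in> ?W \<and> \<pi> (\<pi> u) = u" if "u \<in> ?W" for u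
      using that less.prems(2)[of u] less.prems(2)[OF v] by (metis DiffD1 DiffD2 DiffI insert_iff singletonD)
    note IH = less.hyps[OF W(2,1) inv]
    have O: "\<pi> ` ?O = ?O" using less.prems(2)[OF v] by auto
    let ?F = "\<lambda>V. {B. B \<subseteq> V \<and> \<pi> ` B = B}"
    have fin: "finite (?F ?W)" by (rule finite_subset[of _ "Pow ?W"]) (use W(1) in auto)
    have union: "?F V = ?F ?W \<union> (\<lambda>B. ?O \<union> B) ` ?F ?W"
    proof (intro equalityI subsetI)
      fix B assume B: "B \<in> ?F V"
      show "B \<in> ?F ?W \<union> (\<lambda>B. ?O \<union> B) ` ?F ?W"
      proof (cases "v \<in> B")
        case True
        then have OB: "?O \<subseteq> B" using B by auto
        have "\<pi> ` (B - ?O) = B - ?O"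
        proof (intro equalityI subsetI)
          fix u assume "u \<in> \<pi> ` (B - ?O)"
          then obtain w where w: "u = \<pi> w" "w \<in> B - ?O" by auto
          then have "u \<in> ?W" using inv[of w] B by auto
          moreover have "u \<in> B" using w B by auto
          ultimately show "u \<in> B - ?O" by auto
        next
          fix u assume u: "u \<in> B - ?O"
          then have "\<pi> u \<in> B" using B by auto
          moreover have "\<pi> u \<in> ?W" "\<pi> (\<pi> u) = u" using inv[of u] u B by auto
          ultimately show "u \<in> \<pi> ` (B - ?O)" by (metis DiffD2 DiffI imageI)
        qed
        then have "B - ?O \<in> ?F ?W" using B by auto
        moreover have "B = ?O \<union> (B - ?O)" using OB by auto
        ultimately show ?thesis by blast
      next
        case False
        have "\<pi> v \<notin> B"
        proof
          assume "\<pi> v \<in> B"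
          then have "\<pi> (\<pi> v) \<in> B" using B by blast
          then show False using False less.prems(2)[OF v] by simp
        qed
        then show ?thesis using False B by auto
      qed
    next
      fix B assume "B \<in> ?F ?W \<union> (\<lambda>B. ?O \<union> B) ` ?F ?W"
      then show "B \<in> ?F V"
      proof
        assume "B \<in> (\<lambda>B. ?O \<union> B) ` ?F ?W"
        then obtain C where C: "B = ?O \<union> C" "C \<subseteq> ?W" "\<pi> ` C = C" by auto
        then show ?thesis using O v less.prems(2)[OF v] by (auto simp del: image_insert simp: image_Un)
      qed auto
    qed
    have inj: "inj_on (\<lambda>B. ?O \<union> B) (?F ?W)" by (rule inj_onI) blast
    have disj: "?F ?W \<inter> (\<lambda>B. ?O \<union> B) ` ?F ?W = {}" by auto
    have "(\<Sum>B\<in>?F V. x ^ card B) = (\<Sum>B\<in>?F ?W. x ^ card B) + (\<Sum>B\<in>(\<lambda>B. ?O \<union> B) ` ?F ?W. x ^ card B)"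
      unfolding union using fin disj by (intro sum.union_disjoint) auto
    also have "(\<Sum>B\<in>(\<lambda>B. ?O \<union> B) ` ?F ?W. x ^ card B) = (\<Sum>B\<in>?F ?W. x ^ card (?O \<union> B))"
      using inj by (simp only: sum.reindex o_def)
    also have "\<dots> = (\<Sum>B\<in>?F ?W. x ^ card ?O * x ^ card B)"
    proof (intro sum.cong refl)
      fix B assume B: "B \<in> ?F ?W"
      then have "finite B" using W(1) finite_subset by blast
      then have "card (?O \<union> B) = card ?O + card B" using B by (intro card_Un_disjoint) auto
      then show "x ^ card (?O \<union> B) = x ^ card ?O * x ^ card B" by (simp only: power_add)
    qed
    also have "\<dots> = x ^ card ?O * (\<Sum>B\<in>?F ?W. x ^ card B)" by (simp only: sum_distrib_left)
    finally have sum: "(\<Sum>B\<in>?F V. x ^ card B) = (1 + x ^ card ?O) * (\<Sum>B\<in>?F ?W. x ^ card B)"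
      by (simp only: distrib_right mult_1_left)
    show ?thesis
    proof (cases "\<pi> v = v")
      case True
      have 1: "{u \<in> V. \<pi> u \<noteq> u} = {u \<in> ?W. \<pi> u \<noteq> u}" using True by auto
      have "{u \<in> V. \<pi> u = u} = insert v {u \<in> ?W. \<pi> u = u}" using True v by auto
      then have "card {u \<in> V. \<pi> u = u} = Suc (card {u \<in> ?W. \<pi> u = u})" using W(1) by simp
      then show ?thesis using IH sum True unfolding 1 by (simp add: mult_ac)
    next
      case False
      have 1: "{u \<in> V. \<pi> u = u} = {u \<in> ?W. \<pi> u = u}" using False less.prems(2)[OF v] by auto
      have "{u \<in> V. \<pi> u \<noteq> u} = insert v (insert (\<pi> v) {u \<in> ?W. \<pi> u \<noteq> u})"
        using False v less.prems(2)[OF v] by auto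
      then have 2: "card {u \<in> V. \<pi> u \<noteq> u} = card {u \<in> ?W. \<pi> u \<noteq> u} + 2" using W(1) False by simp
      have "card ?O = 2" using False by simp
      then show ?thesis using IH sum unfolding 1 2 by (simp add: mult_ac)
    qed
  qed
qed

section \<open>Immanants of two-row shapes\<close>

definition involution_poly :: "nat \<Rightarrow> nat \<Rightarrow> real poly" where
  "involution_poly n j = [:1, -1:] * ([:1, 1:] ^ (n - 2 * j) * [:1, 0, 1:] ^ j)"

lemma irr_char_involution:
  assumes k: "2 * Suc k \<le> n" and p: "\<pi> permutes {0..<n}" and inv: "\<And>u. \<pi> (\<pi> u) = u"
  shows "irr_char [n - Suc k, Suc k] \<pi> =
           of_real (coeff (involution_poly n (card {u \<in> {0..<n}. \<pi> u \<noteq> u} div 2)) (Suc k))"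
proof -
  let ?N = "{0..<n}"
  let ?j = "card {u \<in> ?N. \<pi> u \<noteq> u} div 2"
  let ?F = "{B. B \<subseteq> ?N \<and> \<pi> ` B = B}"
  define G :: "real poly" where "G = (\<Sum>B\<in>?F. [:0, 1:] ^ card B)"
  have ev: "even (card {u \<in> ?N. \<pi> u \<noteq> u})"
    and G: "G = (1 + [:0, 1:]) ^ card {u \<in> ?N. \<pi> u = u} * (1 + [:0, 1:]\<^sup>2) ^ ?j"
    using involution_fixed_subsets[of ?N \<pi> "[:0, 1:] :: real poly"] inv permutes_in_image[OF p]
    unfolding G_def by auto
  have "card {u \<in> ?N. \<pi> u = u} + card {u \<in> ?N. \<pi> u \<noteq> u} = card ({u \<in> ?N. \<pi> u = u} \<union> {u \<in> ?N. \<pi> u \<noteq> u})"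
    by (rule card_Un_disjoint[symmetric]) auto
  also have "{u \<in> ?N. \<pi> u = u} \<union> {u \<in> ?N. \<pi> u \<noteq> u} = ?N" by auto
  finally have "card {u \<in> ?N. \<pi> u = u} = n - 2 * ?j" using ev by simp
  moreover have "1 + [:0, 1:] = [:1, 1 :: real:]" "1 + [:0, 1:]\<^sup>2 = [:1, 0, 1 :: real:]"
    by (simp_all add: one_pCons power2_eq_square)
  ultimately have poly: "involution_poly n ?j = [:1, -1:] * G"
    unfolding involution_poly_def G by simp
  have fin: "finite ?F" by (rule finite_subset[of _ "Pow ?N"]) auto
  have c: "coeff G m = real (card (fixed_subsets \<pi> ?N m))" for m
  proof -
    have "coeff ([:0, 1:] ^ l :: real poly) m = (if l = m then 1 else 0)" for l
      using coeff_monom[of "1::real" l m] by (simp add: monom_altdef)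
    then have "coeff G m = (\<Sum>B\<in>?F. if card B = m then 1 else 0)" by (simp add: G_def coeff_sum)
    also have "\<dots> = real (card {B \<in> ?F. card B = m})"
      using fin by (simp add: sum.If_cases Int_def)
    also have "{B \<in> ?F. card B = m} = fixed_subsets \<pi> ?N m" by (auto simp: fixed_subsets_def)
    finally show ?thesis .
  qed
  show ?thesis unfolding irr_char_two_rows[OF k p] poly by (simp add: c)
qed

lemma binomial_sum_involution_poly:
  assumes "2 * i \<le> n"
  shows "(\<Sum>j\<le>i. real (i choose j) * coeff (involution_poly n j) k) = 2 ^ i * two_row_mult (n - 2 * i) i (int k)"
proof -
  have "(\<Sum>j\<le>i. of_nat (i choose j) * involution_poly n j) =
      [:1, -1:] * ([:1, 1:] ^ (n - 2 * i) * (\<Sum>j\<le>i. of_nat (i choose j) * [:1, 0, 1:] ^ j * ([:1, 1:]\<^sup>2) ^ (i - j)))"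
    unfolding sum_distrib_left
  proof (intro sum.cong refl)
    fix j assume "j \<in> {..i}"
    then have "n - 2 * j = (n - 2 * i) + 2 * (i - j)" using assms by auto
    then have "[:1, 1:] ^ (n - 2 * j) = [:1, 1 :: real:] ^ (n - 2 * i) * ([:1, 1:]\<^sup>2) ^ (i - j)"
      by (simp only: power_add power_mult)
    then show "of_nat (i choose j) * involution_poly n j = [:1, -1:] * ([:1, 1:] ^ (n - 2 * i) *
        (of_nat (i choose j) * [:1, 0, 1:] ^ j * ([:1, 1:]\<^sup>2) ^ (i - j)))"
      unfolding involution_poly_def by (simp only: mult_ac)
  qed
  also have "(\<Sum>j\<le>i. of_nat (i choose j) * [:1, 0, 1:] ^ j * ([:1, 1:]\<^sup>2) ^ (i - j)) = ([:1, 0, 1 :: real:] + [:1, 1:]\<^sup>2) ^ i"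
    by (rule binomial_ring[symmetric])
  also have "[:1, 0, 1 :: real:] + [:1, 1:]\<^sup>2 = smult 2 [:1, 1, 1:]"
    by (simp add: power2_eq_square)
  also have "[:1, -1:] * ([:1, 1:] ^ (n - 2 * i) * smult 2 [:1, 1, 1:] ^ i) = smult (2 ^ i) (two_row_poly (n - 2 * i) i)"
    by (simp only: smult_power mult_smult_right two_row_poly_def mult.assoc)
  finally have "coeff (\<Sum>j\<le>i. of_nat (i choose j) * involution_poly n j) k = 2 ^ i * coeff (two_row_poly (n - 2 * i) i) k"
    by simp
  then show ?thesis
    by (simp add: coeff_sum two_row_mult_def int_coeff_def of_nat_poly)
qed

section \<open>Immanants of the q-Laplacian\<close>

lemma laplacian_prod:
  fixes q :: real
  assumes tree: "is_tree {0..<n} E" and p: "\<pi> permutes {0..<n}"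
  shows "(\<Prod>i = 0..<n. q_laplacian n E (complex_of_real q) $$ (i, \<pi> i)) =
           (if \<pi> \<in> graph_perms {0..<n} E then of_real (matching_weight (q\<^sup>2) {0..<n} E \<pi>) else 0)"
proof -
  let ?N = "{0..<n}"
  let ?c = "\<lambda>i. 1 + q\<^sup>2 * (real (card {e \<in> E. i \<in> e}) - 1)"
  \<comment> \<open>On the diagonal the adjacency matrix tests whether {i, i} = {i} is an
    edge.\<close>
  have loop: "{i} \<notin> E" for i
    using tree by (auto simp: is_tree_def simple_graph_def)
  have entry: "q_laplacian n E (complex_of_real q) $$ (i, \<pi> i) =
      of_real (if \<pi> i = i then ?c i else if {i, \<pi> i} \<in> E then - q else 0)" if "i \<in> ?N" for i
  proof -
    have "\<pi> i < n" using that permutes_in_image[OF p, of i] by simp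
    then show ?thesis using that loop
      by (auto simp: q_laplacian_def degree_matrix_def adjacency_matrix_def)
  qed
  show ?thesis
  proof (cases "\<pi> \<in> graph_perms ?N E")
    case False
    then obtain i where "i \<in> ?N" "\<pi> i \<noteq> i" "{i, \<pi> i} \<notin> E" using p by (auto simp: graph_perms_def)
    then show ?thesis using False entry[of i] by (auto intro!: prod_zero)
  next
    case True
    have inv: "\<pi> (\<pi> u) = u" for u
      by (rule graph_perms_involution[OF is_tree_imp_leaf_tree[OF tree] True])
    have ev: "even (card {u \<in> ?N. \<pi> u \<noteq> u})"
      using involution_fixed_subsets[of ?N \<pi> "0 :: int"] inv permutes_in_image[OF p] by auto
    have "(\<Prod>i\<in>?N. q_laplacian n E (complex_of_real q) $$ (i, \<pi> i)) =
        of_real (\<Prod>i\<in>?N. (if \<pi> i = i then ?c i else 1) * (if \<pi> i \<noteq> i then - q else 1))"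
      unfolding of_real_prod
    proof (intro prod.cong refl)
      fix i assume i: "i \<in> ?N"
      then show "q_laplacian n E (complex_of_real q) $$ (i, \<pi> i) =
          of_real ((if \<pi> i = i then ?c i else 1) * (if \<pi> i \<noteq> i then - q else 1))"
        unfolding entry[OF i] using True by (auto simp: graph_perms_def)
    qed
    also have "(\<Prod>i\<in>?N. (if \<pi> i = i then ?c i else 1) * (if \<pi> i \<noteq> i then - q else 1)) =
        (\<Prod>i\<in>?N. if \<pi> i = i then ?c i else 1) * (- q) ^ card {u \<in> ?N. \<pi> u \<noteq> u}"
      unfolding prod.distrib by (simp add: prod.If_cases Int_def)
    also have "(- q) ^ card {u \<in> ?N. \<pi> u \<noteq> u} = (q\<^sup>2) ^ (card {u \<in> ?N. \<pi> u \<noteq> u} div 2)"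
      using ev by (elim evenE) (simp add: power_mult)
    finally show ?thesis using True by (simp add: matching_weight_def mult.commute)
  qed
qed

text \<open>The expansion is applied with \<open>h j\<close> the character value at an involution
  with j transpositions. It enters as a hypothesis so that both shapes are expressed through the
  same \<open>b\<close>.\<close>

lemma normalized_immanant_two_rows:
  fixes q :: real
  assumes tree: "is_tree {0..<n} E" and k: "2 * Suc k \<le> n"
    and b: "\<And>h :: nat \<Rightarrow> real. (\<Sum>\<pi>\<in>graph_perms {0..<n} E.
      h (card {u \<in> {0..<n}. \<pi> u \<noteq> u} div 2) * matching_weight (q\<^sup>2) {0..<n} E \<pi>)
      = (\<Sum>i\<le>card {0..<n} div 2. b i * (\<Sum>j\<le>i. real (i choose j) * h j))"
  shows "normalized_immanant [n - Suc k, Suc k] (q_laplacian n E (complex_of_real q)) =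
     of_real (\<Sum>i\<le>n div 2. b i * 2 ^ i * (two_row_mult (n - 2 * i) i (int (Suc k)) / ballot n (int (Suc k))))"
proof -
  let ?N = "{0..<n}" and ?G = "graph_perms {0..<n} E"
  let ?j = "\<lambda>\<pi>. card {u \<in> ?N. \<pi> u \<noteq> u} div 2"
  let ?h = "\<lambda>j. coeff (involution_poly n j) (Suc k)"
  let ?\<chi> = "irr_char [n - Suc k, Suc k]"
  let ?M = "q_laplacian n E (complex_of_real q)"
  let ?w = "matching_weight (q\<^sup>2) ?N E"
  have dim: "dim_row ?M = n" by (simp add: q_laplacian_def adjacency_matrix_def)
  \<comment> \<open>The degree is the character value at the involution with j = 0.\<close>
  have id: "?\<chi> id = of_real (ballot n (int (Suc k)))"
    using irr_char_involution[OF k permutes_id]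
    by (simp add: involution_poly_def two_row_mult_def int_coeff_def two_row_poly_def nat_add_distrib)
  have "(\<Sum>\<pi> | \<pi> permutes ?N. ?\<chi> \<pi> * (\<Prod>i = 0..<n. ?M $$ (i, \<pi> i))) =
      (\<Sum>\<pi> | \<pi> permutes ?N. ?\<chi> \<pi> * (if \<pi> \<in> ?G then of_real (?w \<pi>) else 0))"
    by (intro sum.cong refl) (simp only: laplacian_prod[OF tree] mem_Collect_eq)
  also have "\<dots> = (\<Sum>\<pi>\<in>?G. ?\<chi> \<pi> * of_real (?w \<pi>))"
    by (intro sum.mono_neutral_cong_right finite_permutations) (auto simp: graph_perms_def)
  also have "\<dots> = (\<Sum>\<pi>\<in>?G. of_real (?h (?j \<pi>) * ?w \<pi>))"
  proof (intro sum.cong refl)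
    fix \<pi> assume \<pi>: "\<pi> \<in> ?G"
    have "?\<chi> \<pi> = of_real (?h (?j \<pi>))"
      using \<pi> graph_perms_involution[OF is_tree_imp_leaf_tree[OF tree] \<pi>]
      by (intro irr_char_involution[OF k]) (auto simp: graph_perms_def)
    then show "?\<chi> \<pi> * of_real (?w \<pi>) = of_real (?h (?j \<pi>) * ?w \<pi>)" by simp
  qed
  also have "\<dots> = of_real (\<Sum>i\<le>n div 2. b i * (\<Sum>j\<le>i. real (i choose j) * ?h j))"
    using b[of ?h] by (simp only: of_real_sum[symmetric] card_atLeastLessThan diff_zero)
  also have "(\<Sum>i\<le>n div 2. b i * (\<Sum>j\<le>i. real (i choose j) * ?h j)) =
      (\<Sum>i\<le>n div 2. b i * (2 ^ i * two_row_mult (n - 2 * i) i (int (Suc k))))"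
    by (intro sum.cong refl arg_cong2[where f = "(*)"] binomial_sum_involution_poly) auto
  finally show ?thesis
    unfolding normalized_immanant_def dim id
    by (simp add: sum_divide_distrib sum_distrib_left mult_ac)
qed

theorem theorem2:
  fixes n k :: nat and E :: "nat set set" and q :: real
  assumes "n \<ge> 5"
    and "is_tree {0..<n} E"
    and "2 \<le> k" and "k \<le> n div 2"
  shows "normalized_immanant [n - k + 1, k - 1] (q_laplacian n E (complex_of_real q))
           \<ge> normalized_immanant [n - k, k] (q_laplacian n E (complex_of_real q))"
proof -
  \<comment> \<open>Both second rows, k and k - 1, are then visibly of the form \<open>Suc\<close>,
    as the character formula requires.\<close>
  obtain l where l: "k = Suc (Suc l)" using \<open>2 \<le> k\<close> by (metis add_2_eq_Suc nat_le_iff_add)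
  have kn: "2 * Suc (Suc l) \<le> n" "2 * Suc l \<le> n" using assms(4) l by auto
  obtain b :: "nat \<Rightarrow> real" where b0: "\<And>i. i \<ge> 1 \<Longrightarrow> b i \<ge> 0"
    and b: "\<And>h :: nat \<Rightarrow> real. (\<Sum>\<pi>\<in>graph_perms {0..<n} E.
      h (card {u \<in> {0..<n}. \<pi> u \<noteq> u} div 2) * matching_weight (q\<^sup>2) {0..<n} E \<pi>)
      = (\<Sum>i\<le>card {0..<n} div 2. b i * (\<Sum>j\<le>i. real (i choose j) * h j))"
    using matching_expansion[OF is_tree_imp_leaf_tree[OF assms(2)] zero_le_power2[of q]] by blast
  let ?r = "\<lambda>k i. two_row_mult (n - 2 * i) i (int k) / ballot n (int k)"
  have "(\<Sum>i\<le>n div 2. b i * 2 ^ i * ?r (Suc (Suc l)) i) \<le> (\<Sum>i\<le>n div 2. b i * 2 ^ i * ?r (Suc l) i)"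
  proof (rule sum_mono)
    fix i assume i: "i \<in> {..n div 2}"
    show "b i * 2 ^ i * ?r (Suc (Suc l)) i \<le> b i * 2 ^ i * ?r (Suc l) i"
    proof (cases "i = 0")
      case True
      have "ballot n (int (Suc (Suc l))) > 0" "ballot n (int (Suc l)) > 0"
        using kn by (auto intro!: ballot_pos)
      then show ?thesis using True by simp
    next
      case False
      have n: "n - 2 * i + 2 * i = n" using i by auto
      have "?r (Suc (Suc l)) i \<le> ?r (Suc l) i"
        using two_row_ratio_antimono[of "n - 2 * i" i "Suc (Suc l)"] assms(1) kn unfolding n by simp
      then show ?thesis using b0[of i] False by (intro mult_left_mono) auto
    qed
  qed
  moreover have "n - k + 1 = n - Suc l" "k - 1 = Suc l" using kn l by auto
  ultimately show ?thesis
    unfolding l normalized_immanant_two_rows[OF assms(2) kn(1) b]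
    by (simp add: normalized_immanant_two_rows[OF assms(2) kn(2) b] l less_eq_complex_def)
qed

end
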